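(* Let $d\ge1$, let $M$ be the uncentered maximal operator associated to balls defined by the $\ell_\infty$ norm on $\mathbb{R}^d$ (cubes with sides parallel to the coordinate axes), and let $\omega$ be a modulus of continuity. Then $$\|M\|_{\operatorname{Op}(\omega)}=\sup_{t>0}\left\{\inf_{0\le s\le1}\frac1{\omega(t)}\int_{[-s,1]^d}\omega(t\|x\|_\infty)\,\frac{dx}{(1+s)^d}\right\},$$ or equivalently, $$\|M\|_{\operatorname{Op}(\omega)}=\sup_{t>0}\left\{\inf_{0\le s\le1}\frac{d}{(1+s)^d\,\omega(t)}\left[2^d\int_0^s u^{d-1}\omega(tu)\,du+\int_s^1(u+s)^{d-1}\omega(tu)\,du\right]\right\}.$$ Moreover, if the same modulus $\omega$ is chosen for every dimension $d$, then $\|M\|_{\operatorname{Op}(\omega)}$ is nondecreasing in $d$, and $\lim_{d\to\infty}\|M\|_{\operatorname{Op}(\omega)}=1$.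
   Context: On $\mathbb{R}^d$ with the norm $\|\cdot\|_\infty$, the uncentered Hardy-Littlewood maximal function of a locally integrable $f:\mathbb{R}^d\to\mathbb{R}$ is $Mf(x)=\sup_{B\ni x}\frac1{|B|}\int_B|f(y)|\,dy\in[0,\infty]$, the supremum being over all $\ell_\infty$ balls $B$ (of positive finite radius) containing $x$; $|B|$ is Lebesgue measure. A modulus of continuity is a function $\omega:[0,\infty)\to[0,\infty)$ that is continuous, nondecreasing, subadditive, with $\omega(0)=0$, and not identically zero. For $f:\mathbb{R}^d\to\mathbb{R}$ let $\|f\|_{\operatorname{Lip}(\omega)}=\sup_{x\ne y}\frac{|f(x)-f(y)|}{\omega(\|x-y\|_\infty)}$; $\operatorname{Lip}(\omega)$ consists of the $f$ for which this is finite, and $$\|M\|_{\operatorname{Op}(\omega)}=\sup\Big\{\frac{\|Mf\|_{\operatorname{Lip}(\omega)}}{\|f\|_{\operatorname{Lip}(\omega)}}: f\in\operatorname{Lip}(\omega),\ \|f\|_{\operatorname{Lip}(\omega)}\ne0\Big\}.$$ If $Mf\equiv\infty$, it is regarded as constant, i.e. $\|Mf\|_{\operatorname{Lip}(\omega)}=0$. *)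

theory Defs
  imports "HOL-Analysis.Analysis"
begin

text \<open>The dimension varies inside the theorem, so \<open>\<real>\<^sup>d\<close> is not a type here. Its points are the
  functions in \<open>Rd d\<close>, which are arbitrary on \<open>{..<d}\<close> and \<open>undefined\<close> elsewhere; this set is the
  space of \<open>lebesgue_Rd d\<close>. The measure lives on the Borel sets, which changes no integral of a
  nonnegative function (\<open>nn_integral_completion\<close>). Only \<open>d \<ge> 1\<close> is meaningful:
  \<open>sup_norm 0\<close> is the maximum of the empty set.\<close>

abbreviation Rd :: "nat \<Rightarrow> (nat \<Rightarrow> real) set" where
  "Rd d \<equiv> PiE {..<d} (\<lambda>_. UNIV)"

abbreviation lebesgue_Rd :: "nat \<Rightarrow> (nat \<Rightarrow> real) measure" where
  "lebesgue_Rd d \<equiv> PiM {..<d} (\<lambda>_. lborel)"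

definition sup_norm :: "nat \<Rightarrow> (nat \<Rightarrow> real) \<Rightarrow> real" where
  "sup_norm d x = Max ((\<lambda>i. \<bar>x i\<bar>) ` {..<d})"

definition sup_dist :: "nat \<Rightarrow> (nat \<Rightarrow> real) \<Rightarrow> (nat \<Rightarrow> real) \<Rightarrow> real" where
  "sup_dist d x y = sup_norm d (\<lambda>i. x i - y i)"

text \<open>Balls are closed. Open balls would give the same maximal function: an average over a closed
  ball is a limit of averages over slightly larger concentric open balls, and an average over an
  open ball equals that over its closure.\<close>

definition sup_ball :: "nat \<Rightarrow> (nat \<Rightarrow> real) \<Rightarrow> real \<Rightarrow> (nat \<Rightarrow> real) set" where
  "sup_ball d c r = {y \<in> Rd d. sup_dist d c y \<le> r}"

definition maximal :: "nat \<Rightarrow> ((nat \<Rightarrow> real) \<Rightarrow> real) \<Rightarrow> (nat \<Rightarrow> real) \<Rightarrow> ennreal" where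
  "maximal d f x =
     Sup {(\<integral>\<^sup>+ y \<in> sup_ball d c r. ennreal \<bar>f y\<bar> \<partial>lebesgue_Rd d) /
            emeasure (lebesgue_Rd d) (sup_ball d c r)
          | c r. c \<in> Rd d \<and> r > 0 \<and> x \<in> sup_ball d c r}"

definition modulus_of_continuity :: "(real \<Rightarrow> real) \<Rightarrow> bool" where
  "modulus_of_continuity \<omega> \<longleftrightarrow>
     (\<forall>t\<ge>0. \<omega> t \<ge> 0) \<and> continuous_on {0..} \<omega> \<and> mono_on {0..} \<omega> \<and>
     (\<forall>s\<ge>0. \<forall>t\<ge>0. \<omega> (s + t) \<le> \<omega> s + \<omega> t) \<and> \<omega> 0 = 0 \<and> (\<exists>t\<ge>0. \<omega> t \<noteq> 0)"

text \<open>Functions are extended-real valued so that \<open>lip_norm\<close> applies both to \<open>f\<close> and to its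
  maximal function; the constant \<open>\<infinity>\<close> has norm \<open>0\<close>. A function taking the value \<open>\<infinity>\<close> at some but
  not all points has norm \<open>\<infinity>\<close>. A modulus of continuity is positive on \<open>{0<..}\<close>, so the quotients
  have positive denominators.\<close>

definition lip_norm :: "nat \<Rightarrow> (real \<Rightarrow> real) \<Rightarrow> ((nat \<Rightarrow> real) \<Rightarrow> ereal) \<Rightarrow> ereal" where
  "lip_norm d \<omega> F =
     (if \<forall>x\<in>Rd d. F x = \<infinity> then 0
      else Sup {\<bar>F x - F y\<bar> / ereal (\<omega> (sup_dist d x y)) | x y.
                  x \<in> Rd d \<and> y \<in> Rd d \<and> x \<noteq> y})"

definition Lip :: "nat \<Rightarrow> (real \<Rightarrow> real) \<Rightarrow> ((nat \<Rightarrow> real) \<Rightarrow> real) set" where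
  "Lip d \<omega> = {f. lip_norm d \<omega> (\<lambda>x. ereal (f x)) < \<infinity>}"

definition maximal_op_norm :: "nat \<Rightarrow> (real \<Rightarrow> real) \<Rightarrow> ereal" where
  "maximal_op_norm d \<omega> =
     Sup {lip_norm d \<omega> (\<lambda>x. enn2ereal (maximal d f x)) / lip_norm d \<omega> (\<lambda>x. ereal (f x)) | f.
            f \<in> Lip d \<omega> \<and> lip_norm d \<omega> (\<lambda>x. ereal (f x)) \<noteq> 0}"

end

theory Submission
  imports Defs "HOL-Probability.Distribution_Functions" "HOL-Real_Asymp.Real_Asymp"
begin

text \<open>Upper bound: given a ball \<open>B\<close> around \<open>x\<close>, a point \<open>y\<close> at distance \<open>t\<close> and \<open>s \<in> [0, 1]\<close>,
  extend every side of \<open>B\<close> by \<open>t\<close> in the direction of \<open>y\<close> and by \<open>s * t\<close> in the opposite direction.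
  The new ball contains \<open>y\<close>, and the affine map between the two balls moves a uniformly distributed
  point by a vector uniformly distributed on \<open>[-s * t, t]\<^sup>d\<close> up to signs. So the averages of a function
  with Lipschitz constant 1 differ by at most the average of \<open>\<omega> (t * \<parallel>x\<parallel>)\<close> over \<open>[-s, 1]\<^sup>d\<close>.
  Lower bound: the peak \<open>\<omega> t - \<omega> (min \<parallel>z\<parallel> t)\<close> has norm 1, its maximal function is at least \<open>\<omega> t\<close> at the origin,
  and at \<open>(t, \<dots>, t)\<close> the best balls are the cubes \<open>[-s * t, t]\<^sup>d\<close>.\<close>

text \<open>A bound on the difference of two averages must not depend on the ball, whose position
  and radius are arbitrary. Both balls are therefore parametrised by one reference cube, and the
  displacement between the two images of a reference point then depends only on \<open>t\<close>,
  \<open>s\<close> and that point, up to signs. Since \<open>s\<close> is free in this comparison,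
  the infimum appears. A positive \<open>s\<close> can help: in dimension one with
  \<open>\<omega> u = u\<close> the mean over \<open>[-s, 1]\<close> is
  \<open>(1 + s^2) / (2 * (1 + s))\<close>, which is smallest at \<open>s = sqrt 2 - 1\<close>.
  Nothing is lost by stopping at \<open>s = 1\<close>: for the peak the cube
  \<open>[-t, t]^d\<close> already contains the support, and larger balls only dilute the average.
  The limit in the dimension is a concentration effect: most of the volume of
  \<open>[-s, 1]^d\<close> lies where some coordinate is close to 1, uniformly in
  \<open>s\<close>.\<close>

interpretation lborel_product: product_sigma_finite "\<lambda>_::nat. lborel :: real measure"
  by standard

subsection \<open>Balls and cubes\<close>

lemma abs_le_sup_norm: "i < d \<Longrightarrow> \<bar>x i\<bar> \<le> sup_norm d x"
  unfolding sup_norm_def by (intro Max_ge) auto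

lemma sup_norm_le_iff: "d \<ge> 1 \<Longrightarrow> sup_norm d x \<le> r \<longleftrightarrow> (\<forall>i<d. \<bar>x i\<bar> \<le> r)"
  unfolding sup_norm_def by (subst Max_le_iff) (auto simp: lessThan_empty_iff)

lemma sup_norm_nonneg: "d \<ge> 1 \<Longrightarrow> 0 \<le> sup_norm d x"
  using abs_le_sup_norm[of 0 d x] by linarith

lemma sup_norm_cong: "(\<And>i. i < d \<Longrightarrow> \<bar>x i\<bar> = \<bar>y i\<bar>) \<Longrightarrow> sup_norm d x = sup_norm d y"
  unfolding sup_norm_def by (intro arg_cong[where f = Max] image_cong) auto

lemma sup_norm_mono:
  assumes "d \<ge> 1" "\<And>i. i < d \<Longrightarrow> \<bar>x i\<bar> \<le> \<bar>y i\<bar>"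
  shows "sup_norm d x \<le> sup_norm d y"
  using assms abs_le_sup_norm[of _ d y] by (subst sup_norm_le_iff) (auto intro: order_trans)

lemma sup_norm_scale:
  assumes "d \<ge> 1" "0 \<le> t"
  shows "sup_norm d (\<lambda>i. t * x i) = t * sup_norm d x"
proof -
  have "mono (\<lambda>z. t * z)"
    using assms by (auto intro!: monoI mult_left_mono)
  then have "t * Max ((\<lambda>i. \<bar>x i\<bar>) ` {..<d}) = Max ((\<lambda>z. t * z) ` (\<lambda>i. \<bar>x i\<bar>) ` {..<d})"
    using assms by (intro mono_Max_commute) (auto simp: lessThan_empty_iff)
  then show ?thesis
    using assms by (simp add: sup_norm_def image_image abs_mult)
qed

lemma sup_norm_triangle:
  assumes "d \<ge> 1"
  shows "sup_norm d x \<le> sup_norm d y + sup_dist d x y"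
proof -
  have "\<bar>x i\<bar> \<le> sup_norm d y + sup_norm d (\<lambda>i. x i - y i)" if "i < d" for i
    using abs_le_sup_norm[OF that, of y] abs_le_sup_norm[OF that, of "\<lambda>i. x i - y i"] by linarith
  then show ?thesis
    using assms by (simp add: sup_norm_le_iff sup_dist_def)
qed

lemma sup_dist_commute: "sup_dist d x y = sup_dist d y x"
  unfolding sup_dist_def by (intro sup_norm_cong) auto

lemma sup_dist_pos:
  assumes "x \<in> Rd d" "y \<in> Rd d" "x \<noteq> y"
  shows "sup_dist d x y > 0"
proof -
  obtain i where "i < d" "x i \<noteq> y i"
    using assms by (metis PiE_ext lessThan_iff)
  then show ?thesis
    using abs_le_sup_norm[of i d "\<lambda>i. x i - y i"] by (simp add: sup_dist_def)
qed

text \<open>The norm may use fewer coordinates than the space has: the comparison of dimensions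
  \<open>d\<close> and \<open>Suc d\<close> integrates the \<open>d\<close>-norm over the larger
  space.\<close>

lemma measurable_sup_norm:
  assumes "d \<le> e"
  shows "sup_norm d \<in> borel_measurable (lebesgue_Rd e)"
proof -
  have "(\<lambda>x. Max ((\<lambda>i. \<bar>x i\<bar>) ` {..<d})) \<in> borel_measurable (lebesgue_Rd e)"
    using assms by (intro borel_measurable_Max borel_measurable_abs) auto
  then show ?thesis
    by (simp add: sup_norm_def[abs_def])
qed

lemma sup_ball_eq_PiE:
  assumes "d \<ge> 1"
  shows "sup_ball d c r = PiE {..<d} (\<lambda>i. {c i - r..c i + r})"
proof -
  have "\<bar>c i - y i\<bar> \<le> r \<longleftrightarrow> y i \<in> {c i - r..c i + r}" for y i
    by auto
  then show ?thesis
    using assms by (auto simp: sup_ball_def sup_dist_def sup_norm_le_iff PiE_iff extensional_def)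
qed

lemma sets_PiE_lborel[measurable]:
  "(\<And>i. i < d \<Longrightarrow> A i \<in> sets borel) \<Longrightarrow> PiE {..<d} A \<in> sets (lebesgue_Rd d)"
  by (intro sets_PiM_I_finite) auto

lemma emeasure_box:
  assumes "\<And>i. i < d \<Longrightarrow> a i \<le> b i"
  shows "emeasure (lebesgue_Rd d) (PiE {..<d} (\<lambda>i. {a i..b i})) = ennreal (\<Prod>i<d. b i - a i)"
  using assms by (subst lborel_product.emeasure_PiM) (auto intro!: prod_ennreal)

lemma emeasure_sup_ball:
  assumes "d \<ge> 1" "r > 0"
  shows "emeasure (lebesgue_Rd d) (sup_ball d c r) = ennreal ((2 * r) ^ d)"
  using assms by (simp add: sup_ball_eq_PiE emeasure_box)

section \<open>Uniform distribution on the cube \<open>[-1, 1]^d\<close> and its affine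
  images\<close>

definition cube :: "nat \<Rightarrow> (nat \<Rightarrow> real) set" where
  "cube d = PiE {..<d} (\<lambda>_. {-1..1})"

definition cube_prob :: "nat \<Rightarrow> (nat \<Rightarrow> real) measure" where
  "cube_prob d = uniform_measure (lebesgue_Rd d) (cube d)"

text \<open>The signs \<open>\<sigma>\<close> reflect the reference cube. They do not change the
  image ball, but they decide which points of two balls are paired. The restriction puts every value
  into \<open>Rd d\<close>, whatever \<open>v\<close> is.\<close>

definition cube_map :: "nat \<Rightarrow> (nat \<Rightarrow> real) \<Rightarrow> (nat \<Rightarrow> real) \<Rightarrow> real \<Rightarrow> (nat \<Rightarrow> real) \<Rightarrow> nat \<Rightarrow> real" where
  "cube_map d \<sigma> c r v = (\<lambda>i\<in>{..<d}. c i + \<sigma> i * r * v i)"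

lemma cube_in_sets[measurable]: "cube d \<in> sets (lebesgue_Rd d)"
  by (simp add: cube_def)

lemma emeasure_cube: "emeasure (lebesgue_Rd d) (cube d) = ennreal (2 ^ d)"
  by (simp add: cube_def emeasure_box)

lemma sets_cube_prob[measurable_cong]: "sets (cube_prob d) = sets (lebesgue_Rd d)"
  by (simp add: cube_prob_def)

lemma space_cube_prob[simp]: "space (cube_prob d) = Rd d"
  by (simp add: cube_prob_def space_PiM)

lemma prob_space_cube: "prob_space (cube_prob d)"
  unfolding cube_prob_def by (rule prob_space_uniform_measure) (auto simp: emeasure_cube)

lemma emeasure_cube_prob_Rd[simp]: "emeasure (cube_prob d) (Rd d) = 1"
  using prob_space.emeasure_space_1[OF prob_space_cube] by simp

lemma measure_cube_prob_Rd[simp]: "measure (cube_prob d) (Rd d) = 1"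
  by (simp add: measure_def)

lemma AE_cube: "AE v in cube_prob d. v \<in> cube d"
  unfolding cube_prob_def by (rule AE_uniform_measureI) auto

lemma cube_map_measurable[measurable]: "cube_map d \<sigma> c r \<in> lebesgue_Rd d \<rightarrow>\<^sub>M lebesgue_Rd d"
  unfolding cube_map_def[abs_def] by measurable

text \<open>A product measure is determined by its values on products of measurable sets. There the
  map splits into one-dimensional affine maps of slope \<open>r\<close> or \<open>-r\<close>, each
  contributing one factor \<open>r\<close>.\<close>

lemma distr_cube_map:
  assumes \<sigma>: "\<And>i. i < d \<Longrightarrow> \<bar>\<sigma> i\<bar> = 1" and r: "r > 0"
  shows "density (distr (lebesgue_Rd d) (lebesgue_Rd d) (cube_map d \<sigma> c r)) (\<lambda>_. ennreal (r ^ d))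
           = lebesgue_Rd d" (is "?P = _")
proof (rule lborel_product.PiM_eqI)
  fix A :: "nat \<Rightarrow> real set"
  assume A: "\<And>i. i \<in> {..<d} \<Longrightarrow> A i \<in> sets lborel"
  let ?g = "\<lambda>i x. c i + (\<sigma> i * r) * x"
  have meas: "?g i -` A i \<in> sets borel" if "i < d" for i
    using A[of i] that by (intro measurable_sets_borel[of "?g i" borel]) auto
  have 1: "cube_map d \<sigma> c r -` PiE {..<d} A \<inter> Rd d = PiE {..<d} (\<lambda>i. ?g i -` A i)"
    by (auto simp: cube_map_def PiE_iff extensional_def)
  have "emeasure ?P (PiE {..<d} A) =
      ennreal (r ^ d) * emeasure (lebesgue_Rd d) (PiE {..<d} (\<lambda>i. ?g i -` A i))"
    using A by (simp add: emeasure_density nn_integral_cmult_indicator emeasure_distr space_PiM 1)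
  also have "\<dots> = ennreal (r ^ d) * (\<Prod>i<d. emeasure lborel (?g i -` A i))"
    using meas by (subst lborel_product.emeasure_PiM) auto
  also have "\<dots> = (\<Prod>i<d. ennreal r * emeasure lborel (?g i -` A i))"
    using r by (simp add: prod.distrib ennreal_power)
  also have "\<dots> = (\<Prod>i<d. emeasure lborel (A i))"
  proof (rule prod.cong)
    fix i assume i: "i \<in> {..<d}"
    have ne: "\<sigma> i * r \<noteq> 0" and abs: "\<bar>\<sigma> i * r\<bar> = r"
      using \<sigma>[of i] i r by (auto simp: abs_mult)
    have "emeasure lborel (A i) =
        emeasure (density (distr lborel borel (?g i)) (\<lambda>_. ennreal \<bar>\<sigma> i * r\<bar>)) (A i)"
      using lborel_real_affine[OF ne, of "c i"] by simp
    also have "\<dots> = ennreal r * emeasure lborel (?g i -` A i)"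
      using A[OF i] meas[of i] i
      by (simp add: emeasure_density nn_integral_cmult_indicator emeasure_distr abs)
    finally show "ennreal r * emeasure lborel (?g i -` A i) = emeasure lborel (A i)" ..
  qed simp
  finally show "emeasure ?P (PiE {..<d} A) = (\<Prod>i\<in>{..<d}. emeasure lborel (A i))" .
qed auto

lemma cube_map_in_ball_iff:
  assumes "d \<ge> 1" "\<And>i. i < d \<Longrightarrow> \<bar>\<sigma> i\<bar> = 1" "r > 0" "v \<in> Rd d"
  shows "cube_map d \<sigma> c r v \<in> sup_ball d c r \<longleftrightarrow> v \<in> cube d"
proof -
  have "\<bar>\<sigma> i * r * v i\<bar> \<le> r \<longleftrightarrow> \<bar>v i\<bar> \<le> 1" if "i < d" for i
    using assms(2)[OF that] assms(3) by (simp add: abs_mult)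
  moreover have "cube_map d \<sigma> c r v \<in> sup_ball d c r \<longleftrightarrow> (\<forall>i<d. \<bar>\<sigma> i * r * v i\<bar> \<le> r)"
    using assms(1) by (auto simp: sup_ball_def sup_dist_def sup_norm_le_iff cube_map_def)
  moreover have "v \<in> cube d \<longleftrightarrow> (\<forall>i<d. \<bar>v i\<bar> \<le> 1)"
    using assms(4) by (auto simp: cube_def PiE_iff abs_le_iff)
  ultimately show ?thesis by auto
qed

text \<open>Averages over all balls become integrals over one probability space, so that two of them
  can be compared point by point in \<open>v\<close>. The Jacobian \<open>r ^ d\<close> and the
  volume \<open>2 ^ d\<close> of the reference cube combine to the volume of the ball.\<close>

lemma average_sup_ball:
  assumes d: "d \<ge> 1" and \<sigma>: "\<And>i. i < d \<Longrightarrow> \<bar>\<sigma> i\<bar> = 1" and r: "r > 0"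
    and g[measurable]: "g \<in> borel_measurable (lebesgue_Rd d)"
  shows "(\<integral>\<^sup>+y\<in>sup_ball d c r. g y \<partial>lebesgue_Rd d) / emeasure (lebesgue_Rd d) (sup_ball d c r) =
    (\<integral>\<^sup>+v. g (cube_map d \<sigma> c r v) \<partial>cube_prob d)"
proof -
  have [measurable]: "sup_ball d c r \<in> sets (lebesgue_Rd d)"
    using d by (simp add: sup_ball_eq_PiE)
  have "(\<integral>\<^sup>+y\<in>sup_ball d c r. g y \<partial>lebesgue_Rd d) =
      (\<integral>\<^sup>+y\<in>sup_ball d c r. g y \<partial>density (distr (lebesgue_Rd d) (lebesgue_Rd d) (cube_map d \<sigma> c r))
         (\<lambda>_. ennreal (r ^ d)))"
    using distr_cube_map[OF \<sigma> r] by simp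
  also have "\<dots> = ennreal (r ^ d) *
      (\<integral>\<^sup>+v. g (cube_map d \<sigma> c r v) * indicator (sup_ball d c r) (cube_map d \<sigma> c r v) \<partial>lebesgue_Rd d)"
    by (simp add: nn_integral_density nn_integral_distr nn_integral_cmult)
  also have "(\<integral>\<^sup>+v. g (cube_map d \<sigma> c r v) * indicator (sup_ball d c r) (cube_map d \<sigma> c r v) \<partial>lebesgue_Rd d) =
      (\<integral>\<^sup>+v\<in>cube d. g (cube_map d \<sigma> c r v) \<partial>lebesgue_Rd d)"
    using cube_map_in_ball_iff[OF d \<sigma> r]
    by (intro nn_integral_cong) (auto simp: space_PiM split: split_indicator)
  also have "\<dots> = ennreal (2 ^ d) * (\<integral>\<^sup>+v. g (cube_map d \<sigma> c r v) \<partial>cube_prob d)"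
    unfolding cube_prob_def
    by (subst nn_integral_uniform_measure)
      (auto simp: emeasure_cube ennreal_times_divide mult_divide_eq_ennreal mult.commute[of "ennreal (2 ^ d)"])
  finally have "(\<integral>\<^sup>+y\<in>sup_ball d c r. g y \<partial>lebesgue_Rd d) =
      (\<integral>\<^sup>+v. g (cube_map d \<sigma> c r v) \<partial>cube_prob d) * ennreal ((2 * r) ^ d)"
    using r by (simp add: mult.assoc[symmetric] ennreal_mult''[symmetric] power_mult_distrib mult.commute)
  then show ?thesis
    using d r by (simp add: emeasure_sup_ball mult_divide_eq_ennreal)
qed

subsection \<open>Moduli of continuity\<close>

lemma modulus_nonneg: "modulus_of_continuity \<omega> \<Longrightarrow> 0 \<le> t \<Longrightarrow> 0 \<le> \<omega> t"
  by (simp add: modulus_of_continuity_def)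

lemma modulus_zero: "modulus_of_continuity \<omega> \<Longrightarrow> \<omega> 0 = 0"
  by (simp add: modulus_of_continuity_def)

lemma modulus_mono: "modulus_of_continuity \<omega> \<Longrightarrow> 0 \<le> s \<Longrightarrow> s \<le> t \<Longrightarrow> \<omega> s \<le> \<omega> t"
  unfolding modulus_of_continuity_def by (auto intro: mono_onD[of "{0..}" \<omega>])

text \<open>Subadditivity gives \<open>\<omega> (n * t) \<le> n * \<omega> t\<close>; with
  monotonicity, a zero at a single \<open>t > 0\<close> would make \<open>\<omega>\<close> vanish on
  all of \<open>{0..}\<close>.\<close>

lemma modulus_pos:
  assumes \<omega>: "modulus_of_continuity \<omega>" and t: "0 < t"
  shows "0 < \<omega> t"
proof -
  have le: "\<omega> (real n * t) \<le> real n * \<omega> t" for n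
  proof (induction n)
    case (Suc n)
    have "\<omega> (real n * t + t) \<le> \<omega> (real n * t) + \<omega> t"
      using \<omega> t by (simp add: modulus_of_continuity_def)
    with Suc show ?case by (simp add: algebra_simps)
  qed (simp add: modulus_zero[OF \<omega>])
  obtain u where u: "u \<ge> 0" "\<omega> u \<noteq> 0"
    using \<omega> by (auto simp: modulus_of_continuity_def)
  obtain n :: nat where "u / t < real n"
    using reals_Archimedean2 by blast
  then have "u \<le> real n * t"
    using t by (simp add: field_simps)
  then have "0 < real n * \<omega> t"
    using modulus_mono[OF \<omega> u(1)] modulus_nonneg[OF \<omega> u(1)] u(2) le[of n] by fastforce
  then show ?thesis
    by (simp add: zero_less_mult_iff)
qed

lemma modulus_diff:
  assumes \<omega>: "modulus_of_continuity \<omega>" and "0 \<le> a" "0 \<le> b"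
  shows "\<bar>\<omega> a - \<omega> b\<bar> \<le> \<omega> \<bar>a - b\<bar>"
proof -
  have *: "\<omega> b \<le> \<omega> a \<and> \<omega> a - \<omega> b \<le> \<omega> (a - b)" if "0 \<le> b" "b \<le> a" for a b
  proof -
    have "\<forall>s\<ge>0. \<forall>t\<ge>0. \<omega> (s + t) \<le> \<omega> s + \<omega> t"
      using \<omega> by (simp add: modulus_of_continuity_def)
    from this[rule_format, of b "a - b"] show ?thesis
      using that modulus_mono[OF \<omega> that] by simp
  qed
  show ?thesis
    using *[of a b] *[of b a] assms(2,3) by (cases "a \<le> b") auto
qed

text \<open>Nothing is known about \<open>\<omega>\<close> on negative numbers. Composing with
  \<open>max 0\<close> gives a function continuous on the whole line that agrees with
  \<open>\<omega>\<close> on \<open>{0..}\<close>; this device recurs wherever measurability or a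
  limit is needed.\<close>

lemma modulus_continuous:
  assumes "modulus_of_continuity \<omega>"
  shows "continuous_on UNIV (\<lambda>u. \<omega> (max 0 u))"
proof (rule continuous_on_compose2[of "{0..}" \<omega>])
  show "continuous_on {0..} \<omega>"
    using assms by (simp add: modulus_of_continuity_def)
qed (auto intro!: continuous_intros)

lemma modulus_borel[measurable]:
  assumes "modulus_of_continuity \<omega>"
  shows "(\<lambda>u. \<omega> (max 0 u)) \<in> borel_measurable borel"
  using modulus_continuous[OF assms] by (rule borel_measurable_continuous_onI)

lemma modulus_sup_norm_measurable:
  assumes \<omega>: "modulus_of_continuity \<omega>" and d: "d \<ge> 1" "d \<le> e" and t: "0 \<le> t"
  shows "(\<lambda>x. \<omega> (t * sup_norm d x)) \<in> borel_measurable (lebesgue_Rd e)"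
proof -
  note [measurable] = measurable_sup_norm[OF d(2)]
  have "(\<lambda>x. \<omega> (max 0 (t * sup_norm d x))) \<in> borel_measurable (lebesgue_Rd e)"
    by (rule measurable_compose[OF _ modulus_borel[OF \<omega>]]) measurable
  moreover have "max 0 (t * sup_norm d x) = t * sup_norm d x" for x
    using t sup_norm_nonneg[OF d(1)] by simp
  ultimately show ?thesis by simp
qed

section \<open>Lipschitz functions are Borel measurable\<close>

definition lip_bound :: "nat \<Rightarrow> (real \<Rightarrow> real) \<Rightarrow> real \<Rightarrow> ((nat \<Rightarrow> real) \<Rightarrow> real) \<Rightarrow> bool" where
  "lip_bound d \<omega> L f \<longleftrightarrow> (\<forall>x\<in>Rd d. \<forall>y\<in>Rd d. \<bar>f x - f y\<bar> \<le> L * \<omega> (sup_dist d x y))"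

text \<open>Continuity lives on the type of all sequences with the product topology, measurability
  on \<open>Rd d\<close>. So \<open>f\<close> is extended to all sequences by ignoring the
  coordinates from \<open>d\<close> on, shown continuous there, and pulled back along the embedding
  that pads with zeros. The Borel sets of the sequence space are those of the product measure
  space.\<close>

lemma lip_bound_measurable:
  assumes \<omega>: "modulus_of_continuity \<omega>" and d: "d \<ge> 1" and L: "0 \<le> L" and f: "lip_bound d \<omega> L f"
  shows "f \<in> borel_measurable (lebesgue_Rd d)"
proof -
  define F where "F = (\<lambda>x::nat \<Rightarrow> real. f (restrict x {..<d}))"
  have "continuous_on UNIV F"
  proof (clarsimp simp: continuous_on_eq_continuous_at isCont_def)
    fix x :: "nat \<Rightarrow> real"
    \<comment> \<open>The sum dominates the maximum norm and, unlike it, is continuous by the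
      standard rules.\<close>
    let ?b = "\<lambda>y::nat \<Rightarrow> real. L * \<omega> (max 0 (\<Sum>i<d. \<bar>y i - x i\<bar>))"
    have "continuous_on UNIV ?b"
      by (intro continuous_on_mult continuous_on_const continuous_on_compose2[OF modulus_continuous[OF \<omega>]]
          continuous_intros continuous_on_product_coordinates) auto
    then have "(?b \<longlongrightarrow> ?b x) (at x)"
      unfolding continuous_on_def by blast
    then have b: "(?b \<longlongrightarrow> 0) (at x)"
      by (simp add: modulus_zero[OF \<omega>])
    have "\<bar>F y - F x\<bar> \<le> ?b y" for y
    proof -
      let ?D = "sup_dist d (restrict y {..<d}) (restrict x {..<d})"
      have sn: "?D \<le> (\<Sum>i<d. \<bar>y i - x i\<bar>)"
        unfolding sup_dist_def using d by (auto simp: sup_norm_le_iff intro!: member_le_sum)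
      have "\<bar>F y - F x\<bar> \<le> L * \<omega> ?D"
        using f by (auto simp: F_def lip_bound_def)
      also have "\<omega> ?D \<le> \<omega> (max 0 (\<Sum>i<d. \<bar>y i - x i\<bar>))"
        using sn sup_norm_nonneg[OF d] by (intro modulus_mono[OF \<omega>]) (auto simp: sup_dist_def)
      finally show ?thesis
        using L by (simp add: mult_left_mono)
    qed
    then show "(F \<longlongrightarrow> F x) (at x)"
      using Lim_null_comparison[OF _ b, of "\<lambda>y. F y - F x"] by (simp add: LIM_zero_iff)
  qed
  then have "F \<in> borel_measurable borel"
    by (rule borel_measurable_continuous_onI)
  then have F: "F \<in> borel_measurable (PiM UNIV (\<lambda>_. borel))"
    by (subst measurable_cong_sets[OF sets_PiM_equal_borel refl])
  have "(\<lambda>x. \<lambda>i\<in>UNIV. if i < d then x i else 0) \<in> lebesgue_Rd d \<rightarrow>\<^sub>M PiM UNIV (\<lambda>_. borel :: real measure)"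
  proof (rule measurable_restrict)
    show "(\<lambda>x. if i < d then x i else 0) \<in> lebesgue_Rd d \<rightarrow>\<^sub>M borel" for i
      by (cases "i < d") auto
  qed
  from measurable_compose[OF this F] show ?thesis
  proof (rule measurable_cong[THEN iffD1, rotated])
    fix x :: "nat \<Rightarrow> real"
    assume "x \<in> space (lebesgue_Rd d)"
    then have "restrict (\<lambda>i. if i < d then x i else 0) {..<d} = x"
      by (auto simp: space_PiM PiE_iff extensional_def)
    then show "F (\<lambda>i\<in>UNIV. if i < d then x i else 0) = f x"
      by (simp add: F_def)
  qed
qed

subsection \<open>The upper bound\<close>

text \<open>Maps the reference cube onto \<open>[-s, 1]\<^sup>d\<close>.\<close>

abbreviation box_map :: "nat \<Rightarrow> real \<Rightarrow> (nat \<Rightarrow> real) \<Rightarrow> nat \<Rightarrow> real" where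
  "box_map d s \<equiv> cube_map d (\<lambda>_. 1) (\<lambda>_. (1 - s) / 2) ((1 + s) / 2)"

text \<open>This is the average of \<open>\<omega> (t * \<parallel>x\<parallel>)\<close> over
  \<open>[-s, 1]^d\<close>, written as an expectation over the reference cube because the comparison
  of two balls produces it in this form; \<open>box_mean_eq_integral\<close> translates it
  back.\<close>

definition box_mean :: "nat \<Rightarrow> (real \<Rightarrow> real) \<Rightarrow> real \<Rightarrow> real \<Rightarrow> real" where
  "box_mean d \<omega> t s = (\<integral>v. \<omega> (t * sup_norm d (box_map d s v)) \<partial>cube_prob d)"

lemma box_map_bounds:
  assumes "v \<in> cube d" "0 \<le> s" "i < d"
  shows "-s \<le> box_map d s v i" "box_map d s v i \<le> 1"
proof -
  have v: "-1 \<le> v i" "v i \<le> 1"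
    using assms by (auto simp: cube_def PiE_iff)
  have "(1 + s) * (v i + 1) \<ge> 0" "(1 + s) * (1 - v i) \<ge> 0"
    using v assms by (intro mult_nonneg_nonneg; simp)+
  then show "-s \<le> box_map d s v i" "box_map d s v i \<le> 1"
    using assms by (auto simp: cube_map_def field_simps)
qed

lemma sup_norm_box_map_le_1:
  assumes "d \<ge> 1" "v \<in> cube d" "s \<in> {0..1}"
  shows "sup_norm d (box_map d s v) \<le> 1"
proof -
  have "\<bar>box_map d s v i\<bar> \<le> 1" if "i < d" for i
    using box_map_bounds[OF assms(2) _ that, of s] assms(3) by (auto simp: abs_le_iff)
  then show ?thesis
    using assms(1) by (simp add: sup_norm_le_iff)
qed

context
  fixes d :: nat and \<omega> :: "real \<Rightarrow> real" and t s :: real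
  assumes \<omega>: "modulus_of_continuity \<omega>" and d: "d \<ge> 1" and t: "0 \<le> t" and s: "s \<in> {0..1}"
begin

lemma box_integrand_measurable:
  "(\<lambda>v. \<omega> (t * sup_norm d (box_map d s v))) \<in> borel_measurable (cube_prob d)"
proof -
  have "box_map d s \<in> cube_prob d \<rightarrow>\<^sub>M lebesgue_Rd d"
    by measurable
  from measurable_compose[OF this modulus_sup_norm_measurable[OF \<omega> d order_refl t]] show ?thesis .
qed

lemma box_integrand_bounds:
  "AE v in cube_prob d. 0 \<le> \<omega> (t * sup_norm d (box_map d s v)) \<and> \<omega> (t * sup_norm d (box_map d s v)) \<le> \<omega> t"
  using AE_cube
proof eventually_elim
  case (elim v)
  have "0 \<le> t * sup_norm d (box_map d s v)" "t * sup_norm d (box_map d s v) \<le> t"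
    using sup_norm_box_map_le_1[OF d elim s] sup_norm_nonneg[OF d] t
    by (auto intro: mult_left_le)
  then show ?case
    using modulus_mono[OF \<omega>] modulus_nonneg[OF \<omega>] by auto
qed

lemma box_integrand_integrable: "integrable (cube_prob d) (\<lambda>v. \<omega> (t * sup_norm d (box_map d s v)))"
proof -
  interpret prob_space "cube_prob d" by (rule prob_space_cube)
  show ?thesis
    using box_integrand_bounds by (intro integrable_const_bound[of _ "\<omega> t"] box_integrand_measurable) auto
qed

lemma nn_integral_box_mean:
  "(\<integral>\<^sup>+v. ennreal (\<omega> (t * sup_norm d (box_map d s v))) \<partial>cube_prob d) = ennreal (box_mean d \<omega> t s)"
  unfolding box_mean_def using box_integrand_bounds
  by (intro nn_integral_eq_integral box_integrand_integrable) auto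

lemma box_mean_nonneg: "0 \<le> box_mean d \<omega> t s"
  unfolding box_mean_def using box_integrand_bounds by (intro integral_nonneg_AE) auto

lemma box_mean_le: "box_mean d \<omega> t s \<le> \<omega> t"
proof -
  interpret prob_space "cube_prob d" by (rule prob_space_cube)
  show ?thesis
    unfolding box_mean_def
    using box_integrand_bounds box_integrand_integrable by (intro integral_le_const) auto
qed

end

lemma average_le_maximal:
  assumes "c \<in> Rd d" "r > 0" "x \<in> sup_ball d c r"
  shows "(\<integral>\<^sup>+z\<in>sup_ball d c r. ennreal \<bar>f z\<bar> \<partial>lebesgue_Rd d) / emeasure (lebesgue_Rd d) (sup_ball d c r)
    \<le> maximal d f x"
  unfolding maximal_def using assms by (intro Sup_upper) blast

lemma average_le_maximal_add:
  assumes \<omega>: "modulus_of_continuity \<omega>" and d: "d \<ge> 1" and L: "0 \<le> L" and f: "lip_bound d \<omega> L f"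
    and xy: "x \<in> Rd d" "y \<in> Rd d" and s: "s \<in> {0..1}"
    and c: "c \<in> Rd d" and r: "r > 0" and x: "x \<in> sup_ball d c r"
  shows "(\<integral>\<^sup>+z\<in>sup_ball d c r. ennreal \<bar>f z\<bar> \<partial>lebesgue_Rd d) / emeasure (lebesgue_Rd d) (sup_ball d c r)
    \<le> maximal d f y + ennreal (L * box_mean d \<omega> (sup_dist d x y) s)"
proof -
  define t where "t = sup_dist d x y"
  \<comment> \<open>\<open>\<sigma> i\<close> is the direction in which coordinate \<open>i\<close>
    moves from \<open>x\<close> to \<open>y\<close>.\<close>
  define \<sigma> where "\<sigma> = (\<lambda>i. if x i \<le> y i then 1 else -1 :: real)"
  \<comment> \<open>Lengthening a side by \<open>t\<close> at one end and by \<open>s * t\<close> at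
    the other moves its midpoint by half the difference and enlarges the radius by half the
    sum.\<close>
  define c' where "c' = (\<lambda>i\<in>{..<d}. c i + \<sigma> i * ((1 - s) * t / 2))"
  define r' where "r' = r + (1 + s) * t / 2"
  have \<sigma>: "\<bar>\<sigma> i\<bar> = 1" for i
    by (simp add: \<sigma>_def)
  have t: "0 \<le> t"
    using sup_norm_nonneg[OF d] by (simp add: t_def sup_dist_def)
  have r': "r' > 0"
    using r s t by (auto simp: r'_def intro!: add_pos_nonneg)
  have f_meas[measurable]: "f \<in> borel_measurable (lebesgue_Rd d)"
    by (rule lip_bound_measurable[OF \<omega> d L f])
  have y_in: "y \<in> sup_ball d c' r'"
  proof -
    have "c' i - r' \<le> y i \<and> y i \<le> c' i + r'" if i: "i < d" for i
    proof -
      have 1: "c i - r \<le> x i" "x i \<le> c i + r"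
        using x i d by (auto simp: sup_ball_eq_PiE PiE_iff)
      have 2: "\<bar>x i - y i\<bar> \<le> t"
        using abs_le_sup_norm[OF i] by (simp add: t_def sup_dist_def)
      have 3: "0 \<le> s * t"
        using s t by auto
      show ?thesis
        using 1 2 3 i r by (auto simp: c'_def r'_def \<sigma>_def algebra_simps abs_le_iff add_divide_distrib diff_divide_distrib)
    qed
    then show ?thesis
      using xy d by (auto simp: sup_ball_eq_PiE PiE_iff)
  qed
  \<comment> \<open>Ball and direction drop out: coordinate \<open>i\<close> of the displacement is
    \<open>t * box_map d s v i\<close> up to the sign \<open>- \<sigma> i\<close>, and the norm does
    not see signs.\<close>
  have displ: "sup_dist d (cube_map d \<sigma> c r v) (cube_map d \<sigma> c' r' v) = t * sup_norm d (box_map d s v)" for v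
  proof -
    have "sup_dist d (cube_map d \<sigma> c r v) (cube_map d \<sigma> c' r' v) = sup_norm d (\<lambda>i. t * box_map d s v i)"
      unfolding sup_dist_def
    proof (rule sup_norm_cong)
      fix i assume i: "i < d"
      then have "cube_map d \<sigma> c r v i - cube_map d \<sigma> c' r' v i = - \<sigma> i * (t * box_map d s v i)"
        by (simp add: cube_map_def c'_def r'_def field_simps)
      then show "\<bar>cube_map d \<sigma> c r v i - cube_map d \<sigma> c' r' v i\<bar> = \<bar>t * box_map d s v i\<bar>"
        by (simp add: abs_mult \<sigma>)
    qed
    then show ?thesis
      by (simp add: sup_norm_scale[OF d t])
  qed
  have "(\<integral>\<^sup>+z\<in>sup_ball d c r. ennreal \<bar>f z\<bar> \<partial>lebesgue_Rd d) / emeasure (lebesgue_Rd d) (sup_ball d c r)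
      = (\<integral>\<^sup>+v. ennreal \<bar>f (cube_map d \<sigma> c r v)\<bar> \<partial>cube_prob d)"
    by (intro average_sup_ball[OF d \<sigma> r]) auto
  also have "\<dots> \<le> (\<integral>\<^sup>+v. ennreal \<bar>f (cube_map d \<sigma> c' r' v)\<bar> +
      ennreal L * ennreal (\<omega> (t * sup_norm d (box_map d s v))) \<partial>cube_prob d)"
  proof (rule nn_integral_mono)
    fix v
    have "\<bar>f (cube_map d \<sigma> c r v) - f (cube_map d \<sigma> c' r' v)\<bar> \<le> L * \<omega> (t * sup_norm d (box_map d s v))"
      using f unfolding lip_bound_def displ[symmetric] by (auto simp: cube_map_def)
    then have "\<bar>f (cube_map d \<sigma> c r v)\<bar> \<le> \<bar>f (cube_map d \<sigma> c' r' v)\<bar> + L * \<omega> (t * sup_norm d (box_map d s v))"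
      by linarith
    moreover have "0 \<le> \<omega> (t * sup_norm d (box_map d s v))"
      using modulus_nonneg[OF \<omega>] t sup_norm_nonneg[OF d] by simp
    ultimately show "ennreal \<bar>f (cube_map d \<sigma> c r v)\<bar> \<le> ennreal \<bar>f (cube_map d \<sigma> c' r' v)\<bar> +
        ennreal L * ennreal (\<omega> (t * sup_norm d (box_map d s v)))"
      using L by (simp add: ennreal_mult[symmetric] ennreal_plus[symmetric] ennreal_leI del: ennreal_plus)
  qed
  also have "\<dots> = (\<integral>\<^sup>+v. ennreal \<bar>f (cube_map d \<sigma> c' r' v)\<bar> \<partial>cube_prob d) + ennreal L * ennreal (box_mean d \<omega> t s)"
    using box_integrand_measurable[OF \<omega> d t s]
    by (simp add: nn_integral_add nn_integral_cmult nn_integral_box_mean[OF \<omega> d t s])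
  also have "(\<integral>\<^sup>+v. ennreal \<bar>f (cube_map d \<sigma> c' r' v)\<bar> \<partial>cube_prob d) =
      (\<integral>\<^sup>+z\<in>sup_ball d c' r'. ennreal \<bar>f z\<bar> \<partial>lebesgue_Rd d) / emeasure (lebesgue_Rd d) (sup_ball d c' r')"
    by (intro average_sup_ball[OF d \<sigma> r', symmetric]) auto
  also have "\<dots> \<le> maximal d f y"
    using y_in r' by (intro average_le_maximal) (auto simp: c'_def)
  finally show ?thesis
    using L box_mean_nonneg[OF \<omega> d t s] by (simp add: t_def ennreal_mult add_right_mono)
qed

text \<open>The additive form remains meaningful for infinite values, and it shows that a maximal
  function finite at one point is finite at all points.\<close>

lemma maximal_le_maximal:
  assumes "modulus_of_continuity \<omega>" "d \<ge> 1" "0 \<le> L" "lip_bound d \<omega> L f"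
    "x \<in> Rd d" "y \<in> Rd d" "s \<in> {0..1}"
  shows "maximal d f x \<le> maximal d f y + ennreal (L * box_mean d \<omega> (sup_dist d x y) s)"
  unfolding maximal_def[of d f x] using average_le_maximal_add[OF assms] by (intro Sup_least) auto

section \<open>Points on the diagonal and the extended-real Lipschitz norm\<close>

definition diag :: "nat \<Rightarrow> real \<Rightarrow> nat \<Rightarrow> real" where
  "diag d t = (\<lambda>i\<in>{..<d}. t)"

lemma diag_in_Rd[simp]: "diag d t \<in> Rd d"
  by (simp add: diag_def)

lemma sup_norm_const: "d \<ge> 1 \<Longrightarrow> sup_norm d (\<lambda>_. t) = \<bar>t\<bar>"
  by (simp add: sup_norm_def lessThan_empty_iff image_constant_conv)

lemma sup_norm_diag: "d \<ge> 1 \<Longrightarrow> sup_norm d (diag d t) = \<bar>t\<bar>"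
  by (subst sup_norm_cong[of d _ "\<lambda>_. t"]) (simp_all add: diag_def sup_norm_const)

lemma sup_dist_diag: "d \<ge> 1 \<Longrightarrow> sup_dist d (diag d s) (diag d t) = \<bar>s - t\<bar>"
  unfolding sup_dist_def
  by (subst sup_norm_cong[of d _ "\<lambda>_. s - t"]) (simp_all add: diag_def sup_norm_const)

lemma diag_inj: "d \<ge> 1 \<Longrightarrow> s \<noteq> t \<Longrightarrow> diag d s \<noteq> diag d t"
  using sup_dist_diag[of d s t] sup_dist_diag[of d t t] by fastforce

text \<open>The witness \<open>z\<close> excludes the convention for functions that are identically
  \<open>\<infinity>\<close>.\<close>

lemma le_lip_norm:
  assumes "x \<in> Rd d" "y \<in> Rd d" "x \<noteq> y" "z \<in> Rd d" "F z \<noteq> \<infinity>"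
  shows "\<bar>F x - F y\<bar> / ereal (\<omega> (sup_dist d x y)) \<le> lip_norm d \<omega> F"
proof -
  have "lip_norm d \<omega> F = Sup {\<bar>F x - F y\<bar> / ereal (\<omega> (sup_dist d x y)) | x y.
      x \<in> Rd d \<and> y \<in> Rd d \<and> x \<noteq> y}"
    using assms by (auto simp: lip_norm_def)
  then show ?thesis
    using assms(1-3) by (auto intro!: Sup_upper)
qed

text \<open>The quotients need to be bounded only if \<open>F\<close> differs from
  \<open>\<infinity>\<close> somewhere, and this may be used in bounding them. In the other case the
  norm is 0 by convention, which is where \<open>0 \<le> K\<close> enters.\<close>

lemma lip_norm_le:
  assumes "0 \<le> K"
    and "\<And>x y. x \<in> Rd d \<Longrightarrow> y \<in> Rd d \<Longrightarrow> x \<noteq> y \<Longrightarrow> \<not> (\<forall>x\<in>Rd d. F x = \<infinity>) \<Longrightarrow>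
      \<bar>F x - F y\<bar> / ereal (\<omega> (sup_dist d x y)) \<le> K"
  shows "lip_norm d \<omega> F \<le> K"
proof (cases "\<forall>x\<in>Rd d. F x = \<infinity>")
  case True
  then show ?thesis using assms(1) by (simp add: lip_norm_def)
next
  case False
  then have "lip_norm d \<omega> F = Sup {\<bar>F x - F y\<bar> / ereal (\<omega> (sup_dist d x y)) | x y.
      x \<in> Rd d \<and> y \<in> Rd d \<and> x \<noteq> y}"
    unfolding lip_norm_def by (rule if_not_P)
  then show ?thesis
    using assms(2)[OF _ _ _ False] by (auto intro!: Sup_least)
qed

lemma lip_norm_le_ereal:
  assumes \<omega>: "modulus_of_continuity \<omega>" and d: "d \<ge> 1" and L: "0 \<le> L" and f: "lip_bound d \<omega> L f"
  shows "lip_norm d \<omega> (\<lambda>x. ereal (f x)) \<le> ereal L"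
proof (rule lip_norm_le)
  fix x y :: "nat \<Rightarrow> real"
  assume xy: "x \<in> Rd d" "y \<in> Rd d" "x \<noteq> y"
  have "\<omega> (sup_dist d x y) > 0"
    by (intro modulus_pos[OF \<omega>] sup_dist_pos xy)
  then show "\<bar>ereal (f x) - ereal (f y)\<bar> / ereal (\<omega> (sup_dist d x y)) \<le> ereal L"
    using f xy by (simp add: lip_bound_def divide_le_eq)
qed (use L in auto)

text \<open>An empty supremum would be \<open>-\<infinity>\<close>; two diagonal points provide a
  nonnegative quotient.\<close>

lemma lip_norm_nonneg:
  assumes \<omega>: "modulus_of_continuity \<omega>" and d: "d \<ge> 1"
  shows "0 \<le> lip_norm d \<omega> F"
proof (cases "\<forall>x\<in>Rd d. F x = \<infinity>")
  case False
  then obtain z where z: "z \<in> Rd d" "F z \<noteq> \<infinity>" by blast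
  have "0 \<le> \<bar>F (diag d 0) - F (diag d 1)\<bar> / ereal (\<omega> (sup_dist d (diag d 0) (diag d 1)))"
    using modulus_nonneg[OF \<omega>, of 1] by (auto simp: sup_dist_diag[OF d] intro!: zero_le_divide_ereal)
  also have "\<dots> \<le> lip_norm d \<omega> F"
    by (rule le_lip_norm[where z = z]) (use z diag_inj[OF d] in auto)
  finally show ?thesis .
qed (simp add: lip_norm_def)

lemma Lip_obtain_bound:
  assumes \<omega>: "modulus_of_continuity \<omega>" and d: "d \<ge> 1" and f: "f \<in> Lip d \<omega>"
  obtains L where "0 \<le> L" "lip_norm d \<omega> (\<lambda>x. ereal (f x)) = ereal L" "lip_bound d \<omega> L f"
proof -
  obtain L where L: "lip_norm d \<omega> (\<lambda>x. ereal (f x)) = ereal L" "0 \<le> L"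
    using lip_norm_nonneg[OF \<omega> d, of "\<lambda>x. ereal (f x)"] f
    by (cases "lip_norm d \<omega> (\<lambda>x. ereal (f x))") (auto simp: Lip_def)
  have "\<bar>f x - f y\<bar> \<le> L * \<omega> (sup_dist d x y)" if xy: "x \<in> Rd d" "y \<in> Rd d" for x y
  proof (cases "x = y")
    case True
    have "sup_dist d y y = 0"
      unfolding sup_dist_def using sup_norm_const[OF d, of 0] by simp
    then show ?thesis
      using True by (simp add: modulus_zero[OF \<omega>])
  next
    case False
    have "\<omega> (sup_dist d x y) > 0"
      by (intro modulus_pos[OF \<omega>] sup_dist_pos xy False)
    then show ?thesis
      using le_lip_norm[OF xy False xy(1), of "\<lambda>x. ereal (f x)" \<omega>] L(1)
      by (simp add: divide_le_eq)
  qed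
  then show ?thesis
    using that[OF L(2,1)] by (auto simp: lip_bound_def)
qed

text \<open>The common value behind both integral formulas. Upper bound, lower bound, monotonicity
  and limit are all proved for this form.\<close>

definition op_bound :: "nat \<Rightarrow> (real \<Rightarrow> real) \<Rightarrow> ereal" where
  "op_bound d \<omega> = (SUP t\<in>{0<..}. INF s\<in>{0..1}. ereal (1 / \<omega> t * box_mean d \<omega> t s))"

lemma maximal_op_norm_le:
  assumes \<omega>: "modulus_of_continuity \<omega>" and d: "d \<ge> 1"
  shows "maximal_op_norm d \<omega> \<le> op_bound d \<omega>"
  unfolding maximal_op_norm_def
proof (safe intro!: Sup_least)
  fix f assume f: "f \<in> Lip d \<omega>" and nz: "lip_norm d \<omega> (\<lambda>x. ereal (f x)) \<noteq> 0"
  obtain L where L: "0 \<le> L" "lip_norm d \<omega> (\<lambda>x. ereal (f x)) = ereal L" "lip_bound d \<omega> L f"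
    using Lip_obtain_bound[OF \<omega> d f] .
  have Lpos: "L > 0"
    using L(1,2) nz by (cases "L = 0") auto
  have inf_nonneg: "0 \<le> (INF s\<in>{0..1}. ereal (1 / \<omega> t * box_mean d \<omega> t s))" if "t > 0" for t
    using box_mean_nonneg[OF \<omega> d, of t] modulus_nonneg[OF \<omega>, of t] that by (intro INF_greatest) auto
  have "0 \<le> op_bound d \<omega>"
    unfolding op_bound_def by (rule SUP_upper2[of 1]) (use inf_nonneg in auto)
  moreover have "\<bar>enn2ereal (maximal d f x) - enn2ereal (maximal d f y)\<bar> / ereal (\<omega> (sup_dist d x y))
      \<le> ereal L * op_bound d \<omega>"
    if xy: "x \<in> Rd d" "y \<in> Rd d" "x \<noteq> y" and fin: "\<not> (\<forall>x\<in>Rd d. enn2ereal (maximal d f x) = \<infinity>)" for x y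
  proof -
    define t where "t = sup_dist d x y"
    have t: "t > 0"
      using sup_dist_pos[OF xy] by (simp add: t_def)
    have \<omega>t: "\<omega> t > 0"
      by (rule modulus_pos[OF \<omega> t])
    obtain z where z: "z \<in> Rd d" "maximal d f z \<noteq> \<infinity>"
      using fin by auto
    \<comment> \<open>Finiteness spreads from \<open>z\<close> to every point (any \<open>s\<close>
      would do, 0 is taken), so the two values can be treated as real numbers.\<close>
    have "maximal d f w < top" if w: "w \<in> Rd d" for w
    proof -
      have "maximal d f w \<le> maximal d f z + ennreal (L * box_mean d \<omega> (sup_dist d w z) 0)"
        by (rule maximal_le_maximal[OF \<omega> d L(1,3) w z(1)]) simp
      also have "\<dots> < top"
        using z(2) by (simp add: less_top)
      finally show ?thesis .
    qed
    then obtain a b where ab: "0 \<le> a" "maximal d f x = ennreal a" "0 \<le> b" "maximal d f y = ennreal b"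
      using xy by (metis less_top_ennreal)
    \<comment> \<open>The estimate holds for every \<open>s\<close> at the fixed distance
      \<open>t\<close>, so the infimum over \<open>s\<close> is taken before the supremum over
      \<open>t\<close>.\<close>
    have "\<bar>a - b\<bar> / \<omega> t / L \<le> 1 / \<omega> t * box_mean d \<omega> t s" if s: "s \<in> {0..1}" for s
    proof -
      have nn: "0 \<le> L * box_mean d \<omega> t s"
        using L(1) box_mean_nonneg[OF \<omega> d less_imp_le[OF t] s] by simp
      have "ennreal a \<le> ennreal b + ennreal (L * box_mean d \<omega> t s)"
        using maximal_le_maximal[OF \<omega> d L(1,3) xy(1,2) s] ab by (simp add: t_def)
      moreover have "ennreal b \<le> ennreal a + ennreal (L * box_mean d \<omega> t s)"
        using maximal_le_maximal[OF \<omega> d L(1,3) xy(2,1) s] ab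
        by (simp add: t_def sup_dist_commute[of d y x])
      ultimately have "\<bar>a - b\<bar> \<le> L * box_mean d \<omega> t s"
        using ab nn by (simp add: ennreal_plus[symmetric] abs_le_iff algebra_simps del: ennreal_plus)
      then show ?thesis
        using \<omega>t Lpos by (simp add: field_simps)
    qed
    then have "ereal (\<bar>a - b\<bar> / \<omega> t / L) \<le> (INF s\<in>{0..1}. ereal (1 / \<omega> t * box_mean d \<omega> t s))"
      by (intro INF_greatest) auto
    also have "\<dots> \<le> op_bound d \<omega>"
      unfolding op_bound_def by (rule SUP_upper) (use t in auto)
    finally have "ereal L * ereal (\<bar>a - b\<bar> / \<omega> t / L) \<le> ereal L * op_bound d \<omega>"
      using Lpos by (intro ereal_mult_left_mono) auto
    then show ?thesis
      using Lpos \<omega>t ab by (simp add: t_def enn2ereal_ennreal)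
  qed
  ultimately have "lip_norm d \<omega> (\<lambda>x. enn2ereal (maximal d f x)) \<le> ereal L * op_bound d \<omega>"
    using L(1) by (intro lip_norm_le) auto
  then show "lip_norm d \<omega> (\<lambda>x. enn2ereal (maximal d f x)) / lip_norm d \<omega> (\<lambda>x. ereal (f x)) \<le> op_bound d \<omega>"
    using Lpos by (simp add: L(2) ereal_divide_le_pos)
qed

subsection \<open>The lower bound\<close>

text \<open>The steepest descent that \<open>\<omega>\<close> permits, from height
  \<open>\<omega> t\<close> at the origin to 0 at distance \<open>t\<close>. The truncation keeps it
  nonnegative and makes it vanish outside the ball of radius \<open>t\<close>.\<close>

definition peak :: "nat \<Rightarrow> (real \<Rightarrow> real) \<Rightarrow> real \<Rightarrow> (nat \<Rightarrow> real) \<Rightarrow> real" where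
  "peak d \<omega> t z = \<omega> t - \<omega> (min (sup_norm d z) t)"

context
  fixes d :: nat and \<omega> :: "real \<Rightarrow> real" and t :: real
  assumes \<omega>: "modulus_of_continuity \<omega>" and d: "d \<ge> 1" and t: "0 < t"
begin

lemma peak_nonneg: "0 \<le> peak d \<omega> t z"
  using modulus_mono[OF \<omega>, of "min (sup_norm d z) t" t] sup_norm_nonneg[OF d] t by (simp add: peak_def)

text \<open>By subadditivity \<open>\<omega>\<close> changes by at most \<open>\<omega>\<close> of
  the change of its argument, and both the norm and the truncation are 1-Lipschitz.\<close>

lemma lip_bound_peak: "lip_bound d \<omega> 1 (peak d \<omega> t)"
  unfolding lip_bound_def
proof safe
  fix x y :: "nat \<Rightarrow> real"
  let ?a = "min (sup_norm d x) t" and ?b = "min (sup_norm d y) t"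
  have ab: "0 \<le> ?a" "0 \<le> ?b"
    using sup_norm_nonneg[OF d] t by auto
  have "\<bar>peak d \<omega> t x - peak d \<omega> t y\<bar> \<le> \<omega> \<bar>?a - ?b\<bar>"
    using modulus_diff[OF \<omega> ab] by (simp add: peak_def abs_minus_commute)
  also have "\<bar>?a - ?b\<bar> \<le> sup_dist d x y"
    using sup_norm_triangle[OF d, of x y] sup_norm_triangle[OF d, of y x] sup_dist_commute[of d x y] by auto
  then have "\<omega> \<bar>?a - ?b\<bar> \<le> \<omega> (sup_dist d x y)"
    by (intro modulus_mono[OF \<omega>]) auto
  finally show "\<bar>peak d \<omega> t x - peak d \<omega> t y\<bar> \<le> 1 * \<omega> (sup_dist d x y)" by simp
qed

lemma peak_measurable[measurable]: "peak d \<omega> t \<in> borel_measurable (lebesgue_Rd d)"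
  by (rule lip_bound_measurable[OF \<omega> d _ lip_bound_peak]) simp

lemma lip_norm_peak: "lip_norm d \<omega> (\<lambda>x. ereal (peak d \<omega> t x)) = 1"
proof (rule antisym)
  show "lip_norm d \<omega> (\<lambda>x. ereal (peak d \<omega> t x)) \<le> 1"
    using lip_norm_le_ereal[OF \<omega> d _ lip_bound_peak] by (simp add: one_ereal_def)
  have "\<bar>ereal (peak d \<omega> t (diag d 0)) - ereal (peak d \<omega> t (diag d t))\<bar> /
      ereal (\<omega> (sup_dist d (diag d 0) (diag d t))) \<le> lip_norm d \<omega> (\<lambda>x. ereal (peak d \<omega> t x))"
    using diag_inj[OF d, of 0 t] t by (intro le_lip_norm[of _ _ _ "diag d 0"]) auto
  then show "1 \<le> lip_norm d \<omega> (\<lambda>x. ereal (peak d \<omega> t x))"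
    using modulus_pos[OF \<omega> t] t
    by (simp add: peak_def sup_norm_diag[OF d] sup_dist_diag[OF d] modulus_zero[OF \<omega>] one_ereal_def)
qed

text \<open>On the ball of radius \<open>r\<close> about the origin the peak is at least
  \<open>\<omega> t - \<omega> r\<close>, hence so is its average; then \<open>r\<close> tends to 0
  from the right.\<close>

lemma maximal_peak_zero: "ennreal (\<omega> t) \<le> maximal d (peak d \<omega> t) (diag d 0)"
proof -
  interpret prob_space "cube_prob d" by (rule prob_space_cube)
  have le: "ennreal (\<omega> t - \<omega> (max 0 r)) \<le> maximal d (peak d \<omega> t) (diag d 0)" if r: "r > 0" for r
  proof -
    have "AE v in cube_prob d. ennreal (\<omega> t - \<omega> r) \<le>
        ennreal \<bar>peak d \<omega> t (cube_map d (\<lambda>_. 1) (diag d 0) r v)\<bar>"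
      using AE_cube
    proof eventually_elim
      case (elim v)
      then have "v \<in> Rd d" by (auto simp: cube_def)
      then have "cube_map d (\<lambda>_. 1) (diag d 0) r v \<in> sup_ball d (diag d 0) r"
        using elim cube_map_in_ball_iff[OF d _ r] by simp
      then have "sup_norm d (cube_map d (\<lambda>_. 1) (diag d 0) r v) \<le> r"
        using sup_norm_triangle[OF d, of "cube_map d (\<lambda>_. 1) (diag d 0) r v" "diag d 0"]
        by (simp add: sup_ball_def sup_dist_commute[of d _ "diag d 0"] sup_norm_diag[OF d])
      then have "\<omega> (min (sup_norm d (cube_map d (\<lambda>_. 1) (diag d 0) r v)) t) \<le> \<omega> r"
        using sup_norm_nonneg[OF d] t by (intro modulus_mono[OF \<omega>]) auto
      then show ?case
        by (intro ennreal_leI) (simp add: peak_def)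
    qed
    then have "(\<integral>\<^sup>+v. ennreal (\<omega> t - \<omega> r) \<partial>cube_prob d) \<le>
        (\<integral>\<^sup>+v. ennreal \<bar>peak d \<omega> t (cube_map d (\<lambda>_. 1) (diag d 0) r v)\<bar> \<partial>cube_prob d)"
      by (rule nn_integral_mono_AE)
    also have "\<dots> = (\<integral>\<^sup>+z\<in>sup_ball d (diag d 0) r. ennreal \<bar>peak d \<omega> t z\<bar> \<partial>lebesgue_Rd d) /
        emeasure (lebesgue_Rd d) (sup_ball d (diag d 0) r)"
      by (intro average_sup_ball[symmetric] d r) auto
    also have "\<dots> \<le> maximal d (peak d \<omega> t) (diag d 0)"
      using r by (intro average_le_maximal) (auto simp: sup_ball_def sup_dist_diag[OF d])
    finally show ?thesis
      using r by (simp add: emeasure_space_1)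
  qed
  have "((\<lambda>r. \<omega> (max 0 r)) \<longlongrightarrow> \<omega> (max 0 0)) (at 0)"
    using modulus_continuous[OF \<omega>] unfolding continuous_on_def by blast
  then have "((\<lambda>r. \<omega> (max 0 r)) \<longlongrightarrow> 0) (at 0)"
    by (simp add: modulus_zero[OF \<omega>])
  then have "((\<lambda>r. \<omega> (max 0 r)) \<longlongrightarrow> 0) (at_right 0)"
    by (rule tendsto_mono[OF at_le[OF subset_UNIV]])
  then have "((\<lambda>r. ennreal (\<omega> t - \<omega> (max 0 r))) \<longlongrightarrow> ennreal (\<omega> t - 0)) (at_right 0)"
    by (intro tendsto_ennrealI tendsto_intros)
  then have "ennreal (\<omega> t - 0) \<le> maximal d (peak d \<omega> t) (diag d 0)"
    by (rule tendsto_upperbound) (auto simp: eventually_at_right_less intro!: eventually_at_rightI[of 0 1] le)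
  then show ?thesis by simp
qed

text \<open>The left side is the average of the peak over the cube \<open>[-s * t, t]^d\<close>, on
  which the truncation at \<open>t\<close> has no effect.\<close>

lemma peak_box_mean:
  assumes s: "s \<in> {0..1}"
  shows "(\<integral>\<^sup>+v. ennreal (\<omega> t - \<omega> (t * sup_norm d (box_map d s v))) \<partial>cube_prob d) =
    ennreal (\<omega> t - box_mean d \<omega> t s)"
proof -
  interpret prob_space "cube_prob d" by (rule prob_space_cube)
  note int = box_integrand_integrable[OF \<omega> d less_imp_le[OF t] s]
  have "(\<integral>\<^sup>+v. ennreal (\<omega> t - \<omega> (t * sup_norm d (box_map d s v))) \<partial>cube_prob d) =
      ennreal (\<integral>v. \<omega> t - \<omega> (t * sup_norm d (box_map d s v)) \<partial>cube_prob d)"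
    using int box_integrand_bounds[OF \<omega> d less_imp_le[OF t] s]
    by (intro nn_integral_eq_integral) auto
  also have "(\<integral>v. \<omega> t - \<omega> (t * sup_norm d (box_map d s v)) \<partial>cube_prob d) = \<omega> t - box_mean d \<omega> t s"
    using int by (simp add: box_mean_def prob_space)
  finally show ?thesis .
qed

text \<open>For \<open>2 * r \<le> t\<close> the cube \<open>[0, t]\<^sup>d\<close> is mapped affinely onto the ball, and every
  coordinate increases. For \<open>2 * r \<ge> t\<close> the ball meets the support of the peak inside
  \<open>[-s * t, t]\<^sup>d\<close>, which has at most the same volume.\<close>

lemma average_peak_le:
  assumes c: "c \<in> Rd d" and r: "r > 0" and inb: "diag d t \<in> sup_ball d c r"
  obtains s where "s \<in> {0..1}"
    "(\<integral>\<^sup>+z\<in>sup_ball d c r. ennreal \<bar>peak d \<omega> t z\<bar> \<partial>lebesgue_Rd d) / emeasure (lebesgue_Rd d) (sup_ball d c r)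
      \<le> ennreal (\<omega> t - box_mean d \<omega> t s)"
proof -
  have ct: "t \<le> c i + r" if "i < d" for i
    using inb that d by (auto simp: sup_ball_eq_PiE PiE_iff diag_def)
  show ?thesis
  proof (cases "2 * r \<le> t")
    case True
    have "(\<integral>\<^sup>+z\<in>sup_ball d c r. ennreal \<bar>peak d \<omega> t z\<bar> \<partial>lebesgue_Rd d) / emeasure (lebesgue_Rd d) (sup_ball d c r)
        = (\<integral>\<^sup>+v. ennreal \<bar>peak d \<omega> t (cube_map d (\<lambda>_. 1) c r v)\<bar> \<partial>cube_prob d)"
      by (intro average_sup_ball d r) auto
    also have "\<dots> \<le> (\<integral>\<^sup>+v. ennreal (\<omega> t - \<omega> (t * sup_norm d (box_map d 0 v))) \<partial>cube_prob d)"
    proof (rule nn_integral_mono_AE)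
      show "AE v in cube_prob d. ennreal \<bar>peak d \<omega> t (cube_map d (\<lambda>_. 1) c r v)\<bar> \<le>
          ennreal (\<omega> t - \<omega> (t * sup_norm d (box_map d 0 v)))"
        using AE_cube
      proof eventually_elim
        case (elim v)
        have le: "\<bar>t * box_map d 0 v i\<bar> \<le> \<bar>cube_map d (\<lambda>_. 1) c r v i\<bar>" if i: "i < d" for i
        proof -
          have v: "-1 \<le> v i" "v i \<le> 1"
            using elim i by (auto simp: cube_def PiE_iff)
          \<comment> \<open>With \<open>t \<le> c i + r\<close> these give \<open>c i + r * v i
            \<ge> t - r * (1 - v i) \<ge> t - t / 2 * (1 - v i) = t / 2 * (1 + v i) \<ge> 0\<close>,
            so absolute values compare as well.\<close>
          have "0 \<le> (t / 2 - r) * (1 - v i)" "0 \<le> t * (1 + v i)"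
            using True v t by (auto intro!: mult_nonneg_nonneg)
          then show ?thesis
            using ct[OF i] i by (auto simp: cube_map_def field_simps)
        qed
        have "t * sup_norm d (box_map d 0 v) \<le> sup_norm d (cube_map d (\<lambda>_. 1) c r v)"
          using sup_norm_mono[OF d le] sup_norm_scale[OF d less_imp_le[OF t]] by simp
        moreover have "t * sup_norm d (box_map d 0 v) \<le> t"
          using sup_norm_box_map_le_1[OF d elim, of 0] t by (simp add: mult_left_le)
        ultimately have "\<omega> (t * sup_norm d (box_map d 0 v)) \<le> \<omega> (min (sup_norm d (cube_map d (\<lambda>_. 1) c r v)) t)"
          using t sup_norm_nonneg[OF d] by (intro modulus_mono[OF \<omega>]) auto
        then show ?case
          using peak_nonneg by (intro ennreal_leI) (simp add: peak_def)
      qed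
    qed
    also have "\<dots> = ennreal (\<omega> t - box_mean d \<omega> t 0)"
      by (rule peak_box_mean) simp
    finally show ?thesis
      by (intro that[of 0]) auto
  next
    case False
    \<comment> \<open>Chosen so that \<open>[-s * t, t]\<close> has length
      \<open>min (2 * r) (2 * t)\<close>: the side of the ball, capped at the width of the
      support.\<close>
    define s where "s = min (2 * r / t - 1) 1"
    have s: "s \<in> {0..1}" and st: "(1 + s) * t \<le> 2 * r"
      using False t by (auto simp: s_def min_def field_simps)
    define c0 where "c0 = diag d ((1 - s) * t / 2)"
    define r0 where "r0 = (1 + s) * t / 2"
    have r0: "0 < r0" "r0 \<le> r"
      using s t st by (auto simp: r0_def)
    have "(\<integral>\<^sup>+z\<in>sup_ball d c r. ennreal \<bar>peak d \<omega> t z\<bar> \<partial>lebesgue_Rd d) \<le>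
        (\<integral>\<^sup>+z\<in>sup_ball d c0 r0. ennreal \<bar>peak d \<omega> t z\<bar> \<partial>lebesgue_Rd d)"
    proof (rule nn_integral_mono)
      fix z :: "nat \<Rightarrow> real"
      assume "z \<in> space (lebesgue_Rd d)"
      then have z: "z \<in> Rd d" by (simp add: space_PiM)
      \<comment> \<open>In each coordinate the ball lies to the right of
        \<open>c i - r \<ge> t - 2 * r\<close> and the support inside \<open>(-t, t)\<close>; the
        larger of the two left ends is \<open>- (s * t)\<close>.\<close>
      have "z \<in> sup_ball d c0 r0" if zb: "z \<in> sup_ball d c r" and nz: "peak d \<omega> t z \<noteq> 0"
      proof -
        have zt: "sup_norm d z < t"
          using nz by (cases "sup_norm d z < t") (auto simp: peak_def)
        have "c0 i - r0 \<le> z i \<and> z i \<le> c0 i + r0" if i: "i < d" for i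
        proof -
          have 1: "\<bar>z i\<bar> < t"
            using abs_le_sup_norm[OF i, of z] zt by linarith
          have 2: "c i - r \<le> z i"
            using zb i d by (auto simp: sup_ball_eq_PiE PiE_iff)
          have 3: "c0 i - r0 = - (s * t)" "c0 i + r0 = t"
            using i by (simp_all add: c0_def r0_def diag_def field_simps)
          have 4: "s * t = min (2 * r - t) t"
            using t by (simp add: s_def min_def field_simps)
          show ?thesis
            using 1 2 3 4 ct[OF i] by (auto simp: min_def abs_less_iff)
        qed
        then show ?thesis
          using z d by (auto simp: sup_ball_eq_PiE PiE_iff)
      qed
      then show "ennreal \<bar>peak d \<omega> t z\<bar> * indicator (sup_ball d c r) z \<le>
          ennreal \<bar>peak d \<omega> t z\<bar> * indicator (sup_ball d c0 r0) z"
        by (auto split: split_indicator)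
    qed
    then have "(\<integral>\<^sup>+z\<in>sup_ball d c r. ennreal \<bar>peak d \<omega> t z\<bar> \<partial>lebesgue_Rd d) / emeasure (lebesgue_Rd d) (sup_ball d c r)
        \<le> (\<integral>\<^sup>+z\<in>sup_ball d c0 r0. ennreal \<bar>peak d \<omega> t z\<bar> \<partial>lebesgue_Rd d) / emeasure (lebesgue_Rd d) (sup_ball d c0 r0)"
      unfolding emeasure_sup_ball[OF d r] emeasure_sup_ball[OF d r0(1)] divide_ennreal_def
      using r0 r by (intro mult_mono) (auto simp: inverse_ennreal intro!: ennreal_leI le_imp_inverse_le power_mono)
    also have "\<dots> = (\<integral>\<^sup>+v. ennreal \<bar>peak d \<omega> t (cube_map d (\<lambda>_. 1) c0 r0 v)\<bar> \<partial>cube_prob d)"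
      by (intro average_sup_ball d r0) auto
    also have "\<dots> \<le> (\<integral>\<^sup>+v. ennreal (\<omega> t - \<omega> (t * sup_norm d (box_map d s v))) \<partial>cube_prob d)"
    proof (rule nn_integral_mono_AE)
      show "AE v in cube_prob d. ennreal \<bar>peak d \<omega> t (cube_map d (\<lambda>_. 1) c0 r0 v)\<bar> \<le>
          ennreal (\<omega> t - \<omega> (t * sup_norm d (box_map d s v)))"
        using AE_cube
      proof eventually_elim
        case (elim v)
        have "sup_norm d (cube_map d (\<lambda>_. 1) c0 r0 v) = sup_norm d (\<lambda>i. t * box_map d s v i)"
          by (rule sup_norm_cong) (simp add: cube_map_def c0_def r0_def diag_def field_simps)
        then have "sup_norm d (cube_map d (\<lambda>_. 1) c0 r0 v) = t * sup_norm d (box_map d s v)"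
          by (simp add: sup_norm_scale[OF d less_imp_le[OF t]])
        moreover have "t * sup_norm d (box_map d s v) \<le> t"
          using sup_norm_box_map_le_1[OF d elim s] t by (simp add: mult_left_le)
        ultimately have "peak d \<omega> t (cube_map d (\<lambda>_. 1) c0 r0 v) = \<omega> t - \<omega> (t * sup_norm d (box_map d s v))"
          by (simp add: peak_def)
        then show ?case
          using peak_nonneg[of "cube_map d (\<lambda>_. 1) c0 r0 v"] by simp
      qed
    qed
    also have "\<dots> = ennreal (\<omega> t - box_mean d \<omega> t s)"
      by (rule peak_box_mean[OF s])
    finally show ?thesis
      using that[OF s] by blast
  qed
qed

text \<open>Let \<open>k\<close> be the infimum. The maximal function of the peak falls from at
  least \<open>\<omega> t\<close> at the origin to at most
  \<open>\<omega> t - \<omega> t * k\<close> at \<open>diag d t\<close>, a point at distance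
  \<open>t\<close>, while the peak itself has norm 1.\<close>

lemma INF_box_mean_le_op_norm:
  "(INF s\<in>{0..1}. ereal (1 / \<omega> t * box_mean d \<omega> t s)) \<le> maximal_op_norm d \<omega>" (is "?I \<le> _")
proof -
  let ?M = "\<lambda>x. enn2ereal (maximal d (peak d \<omega> t) x)"
  have \<omega>t: "\<omega> t > 0"
    by (rule modulus_pos[OF \<omega> t])
  have "0 \<le> ?I"
    using box_mean_nonneg[OF \<omega> d less_imp_le[OF t]] \<omega>t by (intro INF_greatest) auto
  moreover have "?I \<le> ereal (1 / \<omega> t * box_mean d \<omega> t 0)"
    by (rule INF_lower) simp
  ultimately obtain k where k: "?I = ereal k"
    by (cases ?I) auto
  have k_le: "\<omega> t * k \<le> box_mean d \<omega> t s" if "s \<in> {0..1}" for s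
  proof -
    have "?I \<le> ereal (1 / \<omega> t * box_mean d \<omega> t s)"
      using that by (rule INF_lower)
    then show ?thesis
      unfolding k using \<omega>t by (simp add: field_simps)
  qed
  have "\<omega> t * k \<le> \<omega> t"
    using k_le[of 0] box_mean_le[OF \<omega> d less_imp_le[OF t], of 0] by simp
  have le: "maximal d (peak d \<omega> t) (diag d t) \<le> ennreal (\<omega> t - \<omega> t * k)"
    unfolding maximal_def
  proof (safe intro!: Sup_least)
    fix c r assume c: "c \<in> Rd d" "r > 0" "diag d t \<in> sup_ball d c r"
    obtain s where s: "s \<in> {0..1}"
      "(\<integral>\<^sup>+z\<in>sup_ball d c r. ennreal \<bar>peak d \<omega> t z\<bar> \<partial>lebesgue_Rd d) / emeasure (lebesgue_Rd d) (sup_ball d c r)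
        \<le> ennreal (\<omega> t - box_mean d \<omega> t s)"
      using average_peak_le[OF c] .
    note s(2)
    also have "ennreal (\<omega> t - box_mean d \<omega> t s) \<le> ennreal (\<omega> t - \<omega> t * k)"
      using k_le[OF s(1)] by (intro ennreal_leI) simp
    finally show "(\<integral>\<^sup>+z\<in>sup_ball d c r. ennreal \<bar>peak d \<omega> t z\<bar> \<partial>lebesgue_Rd d) /
        emeasure (lebesgue_Rd d) (sup_ball d c r) \<le> ennreal (\<omega> t - \<omega> t * k)" .
  qed
  \<comment> \<open>Besides bounding the drop, this shows that the maximal function is not
    identically \<open>\<infinity>\<close>, so its norm is given by the quotients.\<close>
  have Mt: "?M (diag d t) \<le> ereal (\<omega> t - \<omega> t * k)"
    using le \<open>\<omega> t * k \<le> \<omega> t\<close> by (simp add: less_eq_ennreal.rep_eq enn2ereal_ennreal)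
  have M0: "ereal (\<omega> t) \<le> ?M (diag d 0)"
    using maximal_peak_zero \<omega>t by (simp add: less_eq_ennreal.rep_eq enn2ereal_ennreal)
  have "ereal (\<omega> t * k) = ereal (\<omega> t) - ereal (\<omega> t - \<omega> t * k)"
    by simp
  also have "\<dots> \<le> ?M (diag d 0) - ?M (diag d t)"
    by (rule ereal_minus_mono[OF M0 Mt])
  also have "\<dots> \<le> \<bar>?M (diag d 0) - ?M (diag d t)\<bar>"
    by (cases "?M (diag d 0) - ?M (diag d t)") auto
  finally have "ereal (\<omega> t * k) / ereal (\<omega> t) \<le> \<bar>?M (diag d 0) - ?M (diag d t)\<bar> / ereal (\<omega> t)"
    using \<omega>t by (intro ereal_divide_right_mono) auto
  also have "\<dots> = \<bar>?M (diag d 0) - ?M (diag d t)\<bar> / ereal (\<omega> (sup_dist d (diag d 0) (diag d t)))"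
    using t by (simp add: sup_dist_diag[OF d])
  also have "\<dots> \<le> lip_norm d \<omega> ?M"
    using diag_inj[OF d, of 0 t] t Mt by (intro le_lip_norm[of _ _ _ "diag d t"]) auto
  also have "\<dots> = lip_norm d \<omega> ?M / lip_norm d \<omega> (\<lambda>x. ereal (peak d \<omega> t x))"
    by (simp add: lip_norm_peak)
  also have "\<dots> \<le> maximal_op_norm d \<omega>"
    unfolding maximal_op_norm_def
    by (rule Sup_upper) (auto simp: Lip_def lip_norm_peak intro!: exI[of _ "peak d \<omega> t"])
  finally show ?thesis
    using k \<omega>t by simp
qed

end

lemma maximal_op_norm_eq:
  assumes "modulus_of_continuity \<omega>" "d \<ge> 1"
  shows "maximal_op_norm d \<omega> = op_bound d \<omega>"
proof (rule antisym)
  show "op_bound d \<omega> \<le> maximal_op_norm d \<omega>"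
    unfolding op_bound_def using INF_box_mean_le_op_norm[OF assms] by (intro SUP_least) auto
qed (rule maximal_op_norm_le[OF assms])

subsection \<open>The two integral formulas\<close>

abbreviation (input) corner_box :: "nat \<Rightarrow> real \<Rightarrow> (nat \<Rightarrow> real) set" where
  "corner_box d s \<equiv> PiE {..<d} (\<lambda>_. {-s..1})"

text \<open>The box \<open>[-s, 1]^d\<close> is itself a ball, with all centre coordinates
  \<open>(1 - s) / 2\<close> and radius \<open>(1 + s) / 2\<close>, so the formula for averages
  applies with all signs 1.\<close>

lemma nn_integral_box:
  assumes \<omega>: "modulus_of_continuity \<omega>" and d: "d \<ge> 1" and t: "0 \<le> t" and s: "s \<in> {0..1}"
  shows "(\<integral>\<^sup>+x\<in>corner_box d s. ennreal (\<omega> (t * sup_norm d x)) \<partial>lebesgue_Rd d) =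
    ennreal ((1 + s) ^ d * box_mean d \<omega> t s)"
proof -
  let ?B = "sup_ball d (\<lambda>_. (1 - s) / 2) ((1 + s) / 2)"
  have r: "(1 + s) / 2 > 0"
    using s by auto
  have B: "?B = corner_box d s"
    unfolding sup_ball_eq_PiE[OF d] by (intro PiE_cong) (auto simp: field_simps)
  have em: "emeasure (lebesgue_Rd d) (corner_box d s) = ennreal ((1 + s) ^ d)"
    using emeasure_sup_ball[OF d r, of "\<lambda>_. (1 - s) / 2"] unfolding B by (simp only: times_divide_eq_right nonzero_mult_div_cancel_left[OF zero_neq_numeral[symmetric]])
  have "(\<integral>\<^sup>+x\<in>corner_box d s. ennreal (\<omega> (t * sup_norm d x)) \<partial>lebesgue_Rd d) / emeasure (lebesgue_Rd d) (corner_box d s) =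
      (\<integral>\<^sup>+v. ennreal (\<omega> (t * sup_norm d (box_map d s v))) \<partial>cube_prob d)"
    unfolding B[symmetric] using modulus_sup_norm_measurable[OF \<omega> d order_refl t]
    by (intro average_sup_ball d r) auto
  also have "\<dots> = ennreal (box_mean d \<omega> t s)"
    by (rule nn_integral_box_mean[OF \<omega> d t s])
  finally have eq: "(\<integral>\<^sup>+x\<in>corner_box d s. ennreal (\<omega> (t * sup_norm d x)) \<partial>lebesgue_Rd d) / ennreal ((1 + s) ^ d) =
      ennreal (box_mean d \<omega> t s)" (is "?I / _ = _")
    by (simp add: em)
  have "?I = ?I / ennreal ((1 + s) ^ d) * ennreal ((1 + s) ^ d)"
    using s by (simp add: ennreal_divide_times divide_ennreal)
  also have "\<dots> = ennreal ((1 + s) ^ d * box_mean d \<omega> t s)"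
    unfolding eq using s box_mean_nonneg[OF \<omega> d t s] by (simp add: ennreal_mult mult.commute)
  finally show ?thesis .
qed

lemma integral_box:
  assumes \<omega>: "modulus_of_continuity \<omega>" and d: "d \<ge> 1" and t: "0 \<le> t" and s: "s \<in> {0..1}"
  shows "(LINT x : corner_box d s | lebesgue_Rd d. \<omega> (t * sup_norm d x)) = (1 + s) ^ d * box_mean d \<omega> t s"
proof -
  have nn: "0 \<le> \<omega> (t * sup_norm d x)" for x
    using modulus_nonneg[OF \<omega>] sup_norm_nonneg[OF d] t by simp
  have "(LINT x : corner_box d s | lebesgue_Rd d. \<omega> (t * sup_norm d x)) =
      enn2real (\<integral>\<^sup>+x. ennreal (indicator (corner_box d s) x *\<^sub>R \<omega> (t * sup_norm d x)) \<partial>lebesgue_Rd d)"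
    unfolding set_lebesgue_integral_def using nn modulus_sup_norm_measurable[OF \<omega> d order_refl t]
    by (intro integral_eq_nn_integral) auto
  also have "(\<integral>\<^sup>+x. ennreal (indicator (corner_box d s) x *\<^sub>R \<omega> (t * sup_norm d x)) \<partial>lebesgue_Rd d) =
      (\<integral>\<^sup>+x\<in>corner_box d s. ennreal (\<omega> (t * sup_norm d x)) \<partial>lebesgue_Rd d)"
    by (intro nn_integral_cong) (auto split: split_indicator)
  finally show ?thesis
    using s box_mean_nonneg[OF \<omega> d t s] by (simp add: nn_integral_box[OF \<omega> d t s])
qed

lemma box_mean_eq_integral:
  assumes \<omega>: "modulus_of_continuity \<omega>" and d: "d \<ge> 1" and t: "0 \<le> t" and s: "s \<in> {0..1}"
  shows "(LINT x : corner_box d s | lebesgue_Rd d. \<omega> (t * sup_norm d x) / (1 + s) ^ d) = box_mean d \<omega> t s"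
  using integral_box[OF assms] s by (simp add: set_integral_divide_zero)

text \<open>Sublevel sets of the norm inside the box are again boxes, so their volume is a power.
  For \<open>u < 0\<close> the interval on the right is empty.\<close>

lemma sup_norm_le_in_box:
  assumes d: "d \<ge> 1" and s: "s \<in> {0..1}"
  shows "{x \<in> corner_box d s. sup_norm d x \<le> u} = PiE {..<d} (\<lambda>_. {- min s (min u 1)..min u 1})"
proof -
  have *: "-s \<le> z \<and> z \<le> 1 \<and> \<bar>z\<bar> \<le> u \<longleftrightarrow> z \<in> {- min s (min u 1)..min u 1}" for z
    using s by (auto simp: min_def abs_le_iff)
  have "x \<in> {x \<in> corner_box d s. sup_norm d x \<le> u} \<longleftrightarrow>
      x \<in> extensional {..<d} \<and> (\<forall>i<d. -s \<le> x i \<and> x i \<le> 1 \<and> \<bar>x i\<bar> \<le> u)" for x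
    using d by (auto simp: sup_norm_le_iff PiE_iff)
  then show ?thesis
    unfolding * by (intro set_eqI) (simp only: PiE_iff lessThan_iff conj_commute Ball_def)
qed

text \<open>The push-forward of Lebesgue measure on \<open>[-s, 1]\<^sup>d\<close> under the norm has distribution
  function \<open>u \<mapsto> (u + min s u)\<^sup>d\<close> on \<open>[0, 1]\<close>.\<close>

lemma distr_sup_norm_box:
  assumes d: "d \<ge> 1" and s: "s \<in> {0..1}"
  shows "distr (density (lebesgue_Rd d) (indicator (corner_box d s))) borel (sup_norm d) =
    density lborel (\<lambda>u. ennreal (real d * (2 ^ d * u ^ (d - 1) * indicator {0..s} u +
      (u + s) ^ (d - 1) * indicator {s..1} u)))" (is "?M = ?N")
proof (rule cdf_unique')
  note [measurable] = measurable_sup_norm[OF order_refl[of d]]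
  have M: "emeasure ?M {..u} = ennreal (if u < 0 then 0 else (min u 1 + min s (min u 1)) ^ d)" for u
  proof -
    have "emeasure ?M {..u} = emeasure (density (lebesgue_Rd d) (indicator (corner_box d s))) (sup_norm d -` {..u} \<inter> Rd d)"
      by (subst emeasure_distr) (auto simp: space_PiM)
    also have "\<dots> = (\<integral>\<^sup>+x. indicator (corner_box d s) x * indicator (sup_norm d -` {..u} \<inter> Rd d) x \<partial>lebesgue_Rd d)"
      using measurable_sets[OF measurable_sup_norm[OF order_refl[of d]], of "{..u}"]
      by (intro emeasure_density) (auto simp: space_PiM)
    also have "\<dots> = (\<integral>\<^sup>+x. indicator {x \<in> corner_box d s. sup_norm d x \<le> u} x \<partial>lebesgue_Rd d)"
      by (intro nn_integral_cong) (auto simp: space_PiM split: split_indicator)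
    also have "\<dots> = emeasure (lebesgue_Rd d) (PiE {..<d} (\<lambda>_. {- min s (min u 1)..min u 1}))"
      unfolding sup_norm_le_in_box[OF d s] by (intro nn_integral_indicator) auto
    also have "\<dots> = ennreal (if u < 0 then 0 else (min u 1 + min s (min u 1)) ^ d)"
    proof (cases "u < 0")
      case True
      then have "PiE {..<d} (\<lambda>_. {- min s (min u 1)..min u 1}) = {}"
        using d s by (auto simp: PiE_eq_empty_iff intro!: exI[of _ "0::nat"])
      then show ?thesis using True by simp
    next
      case False
      then show ?thesis using s by (subst emeasure_box) (auto simp: min_def)
    qed
    finally show ?thesis .
  qed
  have N: "emeasure ?N {..u} = ennreal (if u < 0 then 0 else (min u 1 + min s (min u 1)) ^ d)" for u
  proof -
    define y where "y = min u 1"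
    have "emeasure ?N {..u} = (\<integral>\<^sup>+z. ennreal (real d * (2 ^ d * z ^ (d - 1) * indicator {0..s} z +
      (z + s) ^ (d - 1) * indicator {s..1} z)) * indicator {..u} z \<partial>lborel)"
      by (intro emeasure_density) auto
    \<comment> \<open>At \<open>z = s\<close> both terms of the density are present, on both sides
      of the equation, so no null set has to be removed.\<close>
    also have "\<dots> = (\<integral>\<^sup>+z. ennreal (real d * 2 ^ d * z ^ (d - 1)) * indicator {0..min s y} z +
        ennreal (real d * (z + s) ^ (d - 1)) * indicator {s..y} z \<partial>lborel)"
      using s by (intro nn_integral_cong)
        (auto simp: y_def ennreal_plus[symmetric] algebra_simps split: split_indicator simp del: ennreal_plus)
    also have "\<dots> = (\<integral>\<^sup>+z. ennreal (real d * 2 ^ d * z ^ (d - 1)) * indicator {0..min s y} z \<partial>lborel) +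
        (\<integral>\<^sup>+z. ennreal (real d * (z + s) ^ (d - 1)) * indicator {s..y} z \<partial>lborel)"
      by (intro nn_integral_add) auto
    also have "\<dots> = ennreal (if u < 0 then 0 else (y + min s y) ^ d)"
    proof (cases "u < 0")
      case True
      then show ?thesis using s by (simp add: y_def)
    next
      case u: False
      then have y: "0 \<le> y" by (simp add: y_def)
      \<comment> \<open>Below \<open>s\<close> the interval \<open>[-z, z]\<close> grows at both
        ends, beyond \<open>s\<close> the interval \<open>[-s, z]\<close> only at the right: hence
        the antiderivatives \<open>(z + z) ^ d\<close> and \<open>(z + s) ^ d\<close>, which agree
        at \<open>z = s\<close> and telescope.\<close>
      have 1: "(\<integral>\<^sup>+z. ennreal (real d * 2 ^ d * z ^ (d - 1)) * indicator {0..min s y} z \<partial>lborel) =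
          ennreal ((min s y + min s y) ^ d - (0 + 0) ^ d)"
      proof (rule nn_integral_FTC_Icc[where F = "\<lambda>z. (z + z) ^ d"])
        fix z :: real
        have dd: "2 ^ d = 2 ^ (d - 1) * (2::real)"
          using d by (cases d) auto
        have "((\<lambda>z. (2 * z) ^ d) has_real_derivative real d * ((2 * z) ^ (d - 1) * 2)) (at z)"
          using dd by (auto intro!: derivative_eq_intros)
        moreover have "real d * ((2 * z) ^ (d - 1) * 2) = real d * 2 ^ d * z ^ (d - 1)"
          using d by (cases d) (auto simp: power_mult_distrib)
        ultimately show "((\<lambda>z. (z + z) ^ d) has_real_derivative real d * 2 ^ d * z ^ (d - 1)) (at z)"
          by (simp only: mult_2)
      qed (use s y in auto)
      have zero: "(0 + 0 :: real) ^ d = 0"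
        using d by simp
      show ?thesis
      proof (cases "y < s")
        case True
        then have "min s y = y" "{s..y} = {}"
          by auto
        then show ?thesis
          using u unfolding 1 zero by simp
      next
        case False
        have 2: "(\<integral>\<^sup>+z. ennreal (real d * (z + s) ^ (d - 1)) * indicator {s..y} z \<partial>lborel) =
            ennreal ((y + s) ^ d - (s + s) ^ d)"
        proof (rule nn_integral_FTC_Icc[where F = "\<lambda>z. (z + s) ^ d"])
          fix z :: real
          show "((\<lambda>z. (z + s) ^ d) has_real_derivative real d * (z + s) ^ (d - 1)) (at z)"
            by (auto intro!: derivative_eq_intros)
        qed (use s False in auto)
        have "(s + s) ^ d \<le> (y + s) ^ d"
          using s False by (intro power_mono) auto
        moreover have "min s y = s"
          using False by simp
        ultimately show ?thesis
          using u s unfolding 1 2 zero by (simp add: ennreal_plus[symmetric] del: ennreal_plus)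
      qed
    qed
    finally show ?thesis by (simp add: y_def)
  qed
  \<comment> \<open>Finiteness of both measures is read off from their common distribution function,
    which is bounded by \<open>(1 + s) ^ d\<close>.\<close>
  have fin: "finite_borel_measure K" if sets: "sets K = sets borel"
    and em: "\<And>u. emeasure K {..u} = ennreal (if u < 0 then 0 else (min u 1 + min s (min u 1)) ^ d)"
    for K :: "real measure"
  proof -
    have lim: "(\<lambda>n. emeasure K {..real n}) \<longlonglongrightarrow> emeasure K (\<Union>n. {..real n})"
      by (rule Lim_emeasure_incseq) (auto simp: incseq_def sets)
    have un: "(\<Union>n. {..real n}) = UNIV"
      using real_arch_simple by auto
    have "emeasure K {..real n} \<le> ennreal ((1 + s) ^ d)" for n
      unfolding em using s by (simp add: min_def power_mono ennreal_leI)
    then have "emeasure K UNIV \<le> ennreal ((1 + s) ^ d)"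
      using lim unfolding un by (intro LIMSEQ_le_const2) auto
    then have "emeasure K (space K) \<noteq> \<infinity>"
      unfolding sets_eq_imp_space_eq[OF sets] by (auto simp: top_unique)
    then show ?thesis
      by (intro finite_borel_measure.intro finite_measureI finite_borel_measure_axioms.intro sets)
  qed
  show "finite_borel_measure ?M"
    by (rule fin[OF _ M]) simp
  show "finite_borel_measure ?N"
    by (rule fin[OF _ N]) simp
  show "cdf ?M = cdf ?N"
    by (simp only: fun_eq_iff cdf_def measure_def M N) simp
qed

lemma integral_box_radial:
  assumes \<omega>: "modulus_of_continuity \<omega>" and d: "d \<ge> 1" and t: "0 \<le> t" and s: "s \<in> {0..1}"
  shows "(LINT x : corner_box d s | lebesgue_Rd d. \<omega> (t * sup_norm d x)) =
    real d * (2 ^ d * (LINT u : {0..s} | lborel. u ^ (d - 1) * \<omega> (t * u)) +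
      (LINT u : {s..1} | lborel. (u + s) ^ (d - 1) * \<omega> (t * u)))"
proof -
  note [measurable] = measurable_sup_norm[OF order_refl[of d]]
  \<comment> \<open>A continuous substitute for \<open>u \<mapsto> \<omega> (t * u)\<close> on the
    whole line; the density lives on \<open>[0, 1]\<close>, where the two agree.\<close>
  define h where "h = (\<lambda>u. \<omega> (max 0 (t * u)))"
  have h_cont: "continuous_on A h" for A
    unfolding h_def
    by (rule continuous_on_compose2[OF modulus_continuous[OF \<omega>]]) (auto intro!: continuous_intros)
  have [measurable]: "h \<in> borel_measurable borel"
    using h_cont by (rule borel_measurable_continuous_onI)
  have h_eq: "h u = \<omega> (t * u)" if "0 \<le> u" for u
    using that t by (simp add: h_def)
  let ?\<rho> = "\<lambda>u. real d * (2 ^ d * u ^ (d - 1) * indicator {0..s} u + (u + s) ^ (d - 1) * indicator {s..1} u)"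
  have int1: "set_integrable lborel {0..s} (\<lambda>u. u ^ (d - 1) * h u)"
    and int2: "set_integrable lborel {s..1} (\<lambda>u. (u + s) ^ (d - 1) * h u)"
    unfolding set_integrable_def
    by (intro borel_integrable_compact; auto intro!: continuous_intros h_cont)+
  have "(LINT x : corner_box d s | lebesgue_Rd d. \<omega> (t * sup_norm d x)) =
      (LINT x : corner_box d s | lebesgue_Rd d. h (sup_norm d x))"
    using h_eq sup_norm_nonneg[OF d] by simp
  also have "\<dots> = (\<integral>x. h (sup_norm d x) \<partial>density (lebesgue_Rd d) (\<lambda>x. ennreal (indicator (corner_box d s) x)))"
    unfolding set_lebesgue_integral_def by (subst integral_density) auto
  also have "\<dots> = (\<integral>u. h u \<partial>distr (density (lebesgue_Rd d) (indicator (corner_box d s))) borel (sup_norm d))"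
    by (subst integral_distr) (auto simp: ennreal_indicator)
  also have "\<dots> = (\<integral>u. h u \<partial>density lborel (\<lambda>u. ennreal (?\<rho> u)))"
    unfolding distr_sup_norm_box[OF d s] ..
  also have "\<dots> = (\<integral>u. ?\<rho> u *\<^sub>R h u \<partial>lborel)"
    using s by (intro integral_density) (auto split: split_indicator)
  also have "\<dots> = (\<integral>u. real d * (2 ^ d * (indicator {0..s} u *\<^sub>R (u ^ (d - 1) * h u)) +
      indicator {s..1} u *\<^sub>R ((u + s) ^ (d - 1) * h u)) \<partial>lborel)"
    by (intro Bochner_Integration.integral_cong) (auto simp: algebra_simps)
  also have "\<dots> = real d * (2 ^ d * (LINT u : {0..s} | lborel. u ^ (d - 1) * h u) +
      (LINT u : {s..1} | lborel. (u + s) ^ (d - 1) * h u))"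
    using int1 int2 unfolding set_lebesgue_integral_def set_integrable_def by simp
  also have "(LINT u : {0..s} | lborel. u ^ (d - 1) * h u) = (LINT u : {0..s} | lborel. u ^ (d - 1) * \<omega> (t * u))"
    by (intro set_lebesgue_integral_cong) (auto simp: h_eq)
  also have "(LINT u : {s..1} | lborel. (u + s) ^ (d - 1) * h u) =
      (LINT u : {s..1} | lborel. (u + s) ^ (d - 1) * \<omega> (t * u))"
    using s by (intro set_lebesgue_integral_cong) (auto simp: h_eq)
  finally show ?thesis .
qed

subsection \<open>Dependence on the dimension\<close>

text \<open>Ignoring the last coordinate of a point in the larger box can only lower its norm, and
  by Fubini that coordinate then contributes the factor \<open>1 + s\<close>, which the
  normalisation cancels.\<close>

lemma box_mean_Suc:
  assumes \<omega>: "modulus_of_continuity \<omega>" and d: "d \<ge> 1" and t: "0 \<le> t" and s: "s \<in> {0..1}"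
  shows "box_mean d \<omega> t s \<le> box_mean (Suc d) \<omega> t s"
proof -
  let ?h = "\<lambda>x. ennreal (\<omega> (t * sup_norm d x))"
  have meas: "?h \<in> borel_measurable (lebesgue_Rd (Suc d))" "?h \<in> borel_measurable (lebesgue_Rd d)"
    using modulus_sup_norm_measurable[OF \<omega> d _ t] by auto
  have upd: "?h (x(d := y)) * indicator (corner_box (Suc d) s) (x(d := y)) =
      ?h x * indicator (corner_box d s) x * indicator {-s..1} y" if "x \<in> Rd d" for x y
  proof -
    have "sup_norm d (x(d := y)) = sup_norm d x"
      by (rule sup_norm_cong) auto
    moreover have "x(d := y) \<in> corner_box (Suc d) s \<longleftrightarrow> x \<in> corner_box d s \<and> y \<in> {-s..1}"
      using that by (auto simp: PiE_iff less_Suc_eq extensional_def)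
    ultimately show ?thesis
      by (auto split: split_indicator)
  qed
  have "ennreal ((1 + s) * ((1 + s) ^ d * box_mean d \<omega> t s)) =
      (\<integral>\<^sup>+x\<in>corner_box d s. ?h x \<partial>lebesgue_Rd d) * ennreal (1 + s)"
    using s box_mean_nonneg[OF \<omega> d t s] by (simp add: nn_integral_box[OF \<omega> d t s] ennreal_mult mult.commute)
  also have "\<dots> = (\<integral>\<^sup>+x. ?h x * indicator (corner_box d s) x * ennreal (1 + s) \<partial>lebesgue_Rd d)"
    using meas(2) by (intro nn_integral_multc[symmetric]) auto
  also have "\<dots> = (\<integral>\<^sup>+x. \<integral>\<^sup>+y. ?h (x(d := y)) * indicator (corner_box (Suc d) s) (x(d := y)) \<partial>lborel \<partial>lebesgue_Rd d)"
    using s by (intro nn_integral_cong) (simp add: space_PiM upd nn_integral_cmult add.commute)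
  also have "\<dots> = (\<integral>\<^sup>+x\<in>corner_box (Suc d) s. ?h x \<partial>lebesgue_Rd (Suc d))"
    unfolding lessThan_Suc
    by (rule lborel_product.product_nn_integral_insert[symmetric])
      (use meas(1) in \<open>auto simp: lessThan_Suc[symmetric]\<close>)
  also have "\<dots> \<le> (\<integral>\<^sup>+x\<in>corner_box (Suc d) s. ennreal (\<omega> (t * sup_norm (Suc d) x)) \<partial>lebesgue_Rd (Suc d))"
  proof (intro nn_integral_mono mult_right_mono ennreal_leI modulus_mono[OF \<omega>] mult_left_mono)
    show "sup_norm d x \<le> sup_norm (Suc d) x" for x
      using d abs_le_sup_norm[of _ "Suc d" x] by (simp add: sup_norm_le_iff)
  qed (use t sup_norm_nonneg[OF d] in auto)
  also have "\<dots> = ennreal ((1 + s) ^ Suc d * box_mean (Suc d) \<omega> t s)"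
    using d by (intro nn_integral_box[OF \<omega> _ t s]) simp
  finally have "(1 + s) ^ Suc d * box_mean d \<omega> t s \<le> (1 + s) ^ Suc d * box_mean (Suc d) \<omega> t s"
    using s box_mean_nonneg[OF \<omega> _ t s, of "Suc d"] d by (simp add: ennreal_le_iff mult.assoc)
  then show ?thesis
    using s by (simp add: mult_le_cancel_left_pos)
qed

lemma op_bound_Suc:
  assumes "modulus_of_continuity \<omega>" "d \<ge> 1"
  shows "op_bound d \<omega> \<le> op_bound (Suc d) \<omega>"
  unfolding op_bound_def
  using box_mean_Suc[OF assms] modulus_pos[OF assms(1)]
  by (intro SUP_mono INF_mono bexI) (auto simp: divide_right_mono less_imp_le)

section \<open>The limit as the dimension tends to infinity\<close>

lemma op_bound_le_1:
  assumes \<omega>: "modulus_of_continuity \<omega>" and d: "d \<ge> 1"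
  shows "op_bound d \<omega> \<le> 1"
  unfolding op_bound_def
proof (rule SUP_least)
  fix t :: real assume "t \<in> {0<..}"
  then have "1 / \<omega> t * box_mean d \<omega> t 0 \<le> 1"
    using box_mean_le[OF \<omega> d, of t 0] modulus_pos[OF \<omega>, of t] by simp
  then show "(INF s\<in>{0..1}. ereal (1 / \<omega> t * box_mean d \<omega> t s)) \<le> 1"
    by (intro INF_lower2[of 0]) (auto simp: one_ereal_def)
qed

text \<open>Off the subbox \<open>[-s, 1 - e]^d\<close> some coordinate exceeds
  \<open>1 - e\<close>, and so does the norm. The subbox fills the fraction
  \<open>(1 - e / (1 + s)) ^ d\<close> of the box; replacing \<open>s\<close> by the worst case 1
  makes the bound uniform in \<open>s\<close>, as the infimum requires.\<close>

lemma box_mean_ge: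
  assumes \<omega>: "modulus_of_continuity \<omega>" and d: "d \<ge> 1" and s: "s \<in> {0..1}" and e: "e \<in> {0..1}"
  shows "\<omega> (1 - e) * (1 - (1 - e / 2) ^ d) \<le> box_mean d \<omega> 1 s"
proof -
  let ?S = "PiE {..<d} (\<lambda>_. {-s..1 - e})"
  have nn: "0 \<le> \<omega> (1 - e)"
    using modulus_nonneg[OF \<omega>] e by simp
  have le: "(1 + s - e) ^ d \<le> (1 + s) ^ d"
    using s e by (intro power_mono) auto
  have em: "emeasure (lebesgue_Rd d) (corner_box d s - ?S) = ennreal ((1 + s) ^ d - (1 + s - e) ^ d)"
  proof -
    have 1: "emeasure (lebesgue_Rd d) (corner_box d s) = ennreal ((1 + s) ^ d)"
      using s by (subst emeasure_box) (auto simp: add.commute)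
    have 2: "emeasure (lebesgue_Rd d) ?S = ennreal ((1 + s - e) ^ d)"
      using s e by (subst emeasure_box) (auto simp: algebra_simps)
    have "?S \<subseteq> corner_box d s"
      using e by (intro PiE_mono) auto
    then have "emeasure (lebesgue_Rd d) (corner_box d s - ?S) = emeasure (lebesgue_Rd d) (corner_box d s) - emeasure (lebesgue_Rd d) ?S"
      by (intro emeasure_Diff) (auto simp: 2)
    then show ?thesis
      using s e by (simp add: 1 2 ennreal_minus)
  qed
  have "ennreal (\<omega> (1 - e) * ((1 + s) ^ d - (1 + s - e) ^ d)) =
      (\<integral>\<^sup>+x\<in>corner_box d s - ?S. ennreal (\<omega> (1 - e)) \<partial>lebesgue_Rd d)"
    using nn le by (subst nn_integral_cmult_indicator) (auto simp: em ennreal_mult)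
  also have "\<dots> \<le> (\<integral>\<^sup>+x\<in>corner_box d s. ennreal (\<omega> (1 * sup_norm d x)) \<partial>lebesgue_Rd d)"
  proof (rule nn_integral_mono)
    fix x :: "nat \<Rightarrow> real"
    have "\<omega> (1 - e) \<le> \<omega> (1 * sup_norm d x)" if "x \<in> corner_box d s - ?S"
    proof -
      have "\<not> (\<forall>i<d. x i \<le> 1 - e)"
        using that by (auto simp: PiE_iff)
      then obtain i where "i < d" "x i > 1 - e"
        by (auto simp: not_le)
      then have "1 - e \<le> sup_norm d x"
        using abs_le_sup_norm[of i d x] by linarith
      then show ?thesis
        using e by (intro modulus_mono[OF \<omega>]) auto
    qed
    then show "ennreal (\<omega> (1 - e)) * indicator (corner_box d s - ?S) x \<le>
        ennreal (\<omega> (1 * sup_norm d x)) * indicator (corner_box d s) x"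
      by (cases "x \<in> corner_box d s - ?S") (simp_all add: ennreal_leI)
  qed
  also have "\<dots> = ennreal ((1 + s) ^ d * box_mean d \<omega> 1 s)"
    by (rule nn_integral_box[OF \<omega> d _ s]) simp
  finally have "\<omega> (1 - e) * ((1 + s) ^ d - (1 + s - e) ^ d) \<le> (1 + s) ^ d * box_mean d \<omega> 1 s"
    using s box_mean_nonneg[OF \<omega> d _ s, of 1] by (simp add: ennreal_le_iff)
  moreover have "(1 + s) ^ d * (1 - (1 - e / (1 + s)) ^ d) = (1 + s) ^ d - (1 + s - e) ^ d"
    using s by (simp add: right_diff_distrib power_mult_distrib[symmetric] field_simps)
  ultimately have "(1 + s) ^ d * (\<omega> (1 - e) * (1 - (1 - e / (1 + s)) ^ d)) \<le> (1 + s) ^ d * box_mean d \<omega> 1 s"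
    by (metis mult.left_commute)
  then have "\<omega> (1 - e) * (1 - (1 - e / (1 + s)) ^ d) \<le> box_mean d \<omega> 1 s"
    using s by (simp add: mult_le_cancel_left_pos)
  moreover have "(1 - e / (1 + s)) ^ d \<le> (1 - e / 2) ^ d"
    using s e mult_left_le[of s e] by (intro power_mono) (auto simp: field_simps)
  ultimately show ?thesis
    using nn by (meson diff_left_mono mult_left_mono order_trans)
qed

lemma op_bound_tendsto_1:
  assumes \<omega>: "modulus_of_continuity \<omega>"
  shows "(\<lambda>d. op_bound d \<omega>) \<longlonglongrightarrow> 1"
proof (rule tendsto_sandwich)
  \<comment> \<open>The rate balances two demands: \<open>?e d\<close> tends to 0, so that
    \<open>\<omega> (1 - ?e d)\<close> tends to \<open>\<omega> 1\<close>, while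
    \<open>d * ?e d\<close> tends to infinity, so that the excluded fraction vanishes. The single
    scale \<open>t = 1\<close> is enough for the lower bound.\<close>
  let ?e = "\<lambda>d. 1 / sqrt (real d)"
  let ?l = "\<lambda>d. \<omega> (1 - ?e d) * (1 - (1 - ?e d / 2) ^ d) / \<omega> 1"
  have \<omega>1: "\<omega> 1 > 0"
    by (rule modulus_pos[OF \<omega>]) simp
  have e: "?e d \<in> {0..1}" if "d \<ge> 1" for d
    using that by auto
  have "ereal (?l d) \<le> op_bound d \<omega>" if d: "d \<ge> 1" for d
  proof -
    have "?l d \<le> 1 / \<omega> 1 * box_mean d \<omega> 1 s" if s: "s \<in> {0..1}" for s
      using box_mean_ge[OF \<omega> d s e[OF d]] \<omega>1 by (simp add: divide_right_mono)
    then have "ereal (?l d) \<le> (INF s\<in>{0..1}. ereal (1 / \<omega> 1 * box_mean d \<omega> 1 s))"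
      by (intro INF_greatest) auto
    also have "\<dots> \<le> op_bound d \<omega>"
      unfolding op_bound_def by (rule SUP_upper) simp
    finally show ?thesis .
  qed
  then show "eventually (\<lambda>d. ereal (?l d) \<le> op_bound d \<omega>) sequentially"
    by (intro eventually_sequentiallyI[of 1])
  show "eventually (\<lambda>d. op_bound d \<omega> \<le> 1) sequentially"
    using eventually_ge_at_top[of 1] by eventually_elim (rule op_bound_le_1[OF \<omega>])
  have "(\<lambda>d. max 0 (1 - ?e d)) \<longlonglongrightarrow> 1"
    by real_asymp
  moreover have "isCont (\<lambda>u. \<omega> (max 0 u)) 1"
    using modulus_continuous[OF \<omega>] by (simp add: continuous_on_eq_continuous_at)
  ultimately have "(\<lambda>d. \<omega> (max 0 (max 0 (1 - ?e d)))) \<longlonglongrightarrow> \<omega> (max 0 1)"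
    by (rule isCont_tendsto_compose[rotated])
  then have "(\<lambda>d. \<omega> (max 0 (max 0 (1 - ?e d)))) \<longlonglongrightarrow> \<omega> 1"
    by simp
  then have "(\<lambda>d. \<omega> (1 - ?e d)) \<longlonglongrightarrow> \<omega> 1"
  proof (rule Lim_transform_eventually)
    show "eventually (\<lambda>d. \<omega> (max 0 (max 0 (1 - ?e d))) = \<omega> (1 - ?e d)) sequentially"
      using eventually_ge_at_top[of 1] by eventually_elim (use e in auto)
  qed
  moreover have "(\<lambda>d. (1 - ?e d / 2) ^ d) \<longlonglongrightarrow> 0"
    by real_asymp
  ultimately have "?l \<longlonglongrightarrow> \<omega> 1 * (1 - 0) / \<omega> 1"
    using \<omega>1 by (intro tendsto_intros) auto
  then show "(\<lambda>d. ereal (?l d)) \<longlonglongrightarrow> 1"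
    using \<omega>1 by (simp add: one_ereal_def)
qed simp

theorem theorem3p1:
  fixes \<omega> :: "real \<Rightarrow> real"
  assumes "modulus_of_continuity \<omega>"
  shows
    "(\<forall>d\<ge>1.
        maximal_op_norm d \<omega> =
          (SUP t\<in>{0<..}. INF s\<in>{0..1}.
             ereal (1 / \<omega> t *
               (LINT x : PiE {..<d} (\<lambda>_. {-s..1}) | lebesgue_Rd d.
                  \<omega> (t * sup_norm d x) / (1 + s) ^ d))) \<and>
        maximal_op_norm d \<omega> =
          (SUP t\<in>{0<..}. INF s\<in>{0..1}.
             ereal (real d / ((1 + s) ^ d * \<omega> t) *
               (2 ^ d * (LINT u : {0..s} | lborel. u ^ (d - 1) * \<omega> (t * u)) +
                (LINT u : {s..1} | lborel. (u + s) ^ (d - 1) * \<omega> (t * u)))))) \<and>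
     mono_on {1..} (\<lambda>d. maximal_op_norm d \<omega>) \<and>
     (\<lambda>d. maximal_op_norm d \<omega>) \<longlonglongrightarrow> 1"
proof (intro conjI allI impI)
  fix d :: nat assume d: "d \<ge> 1"
  show "maximal_op_norm d \<omega> =
          (SUP t\<in>{0<..}. INF s\<in>{0..1}.
             ereal (1 / \<omega> t *
               (LINT x : PiE {..<d} (\<lambda>_. {-s..1}) | lebesgue_Rd d.
                  \<omega> (t * sup_norm d x) / (1 + s) ^ d)))"
    unfolding maximal_op_norm_eq[OF assms d] op_bound_def
    by (intro SUP_cong INF_cong refl arg_cong[where f = ereal] arg_cong2[where f = "(*)"]
        box_mean_eq_integral[OF assms d, symmetric]) auto
  \<comment> \<open>The two formulas agree for each \<open>t\<close> and \<open>s\<close>, before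
    any infimum or supremum is taken.\<close>
  have "1 / \<omega> t * box_mean d \<omega> t s = real d / ((1 + s) ^ d * \<omega> t) *
               (2 ^ d * (LINT u : {0..s} | lborel. u ^ (d - 1) * \<omega> (t * u)) +
                (LINT u : {s..1} | lborel. (u + s) ^ (d - 1) * \<omega> (t * u)))"
    if t: "t > 0" and s: "s \<in> {0..1}" for t s
  proof -
    have "box_mean d \<omega> t s = real d *
               (2 ^ d * (LINT u : {0..s} | lborel. u ^ (d - 1) * \<omega> (t * u)) +
                (LINT u : {s..1} | lborel. (u + s) ^ (d - 1) * \<omega> (t * u))) / (1 + s) ^ d"
      using integral_box[OF assms d less_imp_le[OF t] s] integral_box_radial[OF assms d less_imp_le[OF t] s] s
      by (simp add: eq_divide_eq mult.commute)
    then show ?thesis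
      by simp
  qed
  then show "maximal_op_norm d \<omega> =
          (SUP t\<in>{0<..}. INF s\<in>{0..1}.
             ereal (real d / ((1 + s) ^ d * \<omega> t) *
               (2 ^ d * (LINT u : {0..s} | lborel. u ^ (d - 1) * \<omega> (t * u)) +
                (LINT u : {s..1} | lborel. (u + s) ^ (d - 1) * \<omega> (t * u)))))"
    unfolding maximal_op_norm_eq[OF assms d] op_bound_def
    by (intro SUP_cong INF_cong refl) auto
next
  have "op_bound d \<omega> \<le> op_bound e \<omega>" if "d \<ge> 1" "d \<le> e" for d e
    using that(2)
  proof (induction e rule: dec_induct)
    case (step n)
    then show ?case
      using op_bound_Suc[OF assms, of n] that(1) by auto
  qed simp
  then show "mono_on {1..} (\<lambda>d. maximal_op_norm d \<omega>)"
    by (intro mono_onI) (simp add: maximal_op_norm_eq[OF assms])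
  show "(\<lambda>d. maximal_op_norm d \<omega>) \<longlonglongrightarrow> 1"
    using op_bound_tendsto_1[OF assms]
  proof (rule Lim_transform_eventually)
    show "eventually (\<lambda>d. op_bound d \<omega> = maximal_op_norm d \<omega>) sequentially"
      using eventually_ge_at_top[of 1] by eventually_elim (simp add: maximal_op_norm_eq[OF assms])
  qed
qed

end
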